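(* For any Hom-Lie algebra $(L,\alpha_L)$ over $\mathbb F$ with surjective endomorphism $\alpha_L$, there is a short exact sequence of Hom-Lie algebras $$(\Gamma(L^{ab}),\alpha_{\Gamma})\stackrel{\psi}{\rightarrowtail}(L\star L,\alpha_{\star})\twoheadrightarrow(L\curlywedge L,\alpha_{\curlywedge}),$$ where $L\star L\twoheadrightarrow L\curlywedge L$ is the natural projection and $\psi(\gamma(\bar x))=x\star x$ for $x\in L$ with class $\bar x\in L^{ab}$.
   Context: Fix a field $\mathbb F$. A Hom-vector space is a pair $(V,\alpha_V)$ of an $\mathbb F$-vector space and a linear map $\alpha_V:V\to V$; it is an (abelian) Hom-Lie algebra with zero product. A (multiplicative) Hom-Lie algebra $(L,\alpha_L)$ is a Hom-vector space with a bilinear product $[\,,]$ such that $[x,y]=-[y,x]$, $[\alpha_L(x),[y,z]]+[\alpha_L(y),[z,x]]+[\alpha_L(z),[x,y]]=0$ and $\alpha_L([x,y])=[\alpha_L(x),\alpha_L(y)]$. Homomorphisms are algebra homomorphisms commuting with the structure maps. $L^{ab}=L/[L,L]$ with the induced map $\alpha_{L^{ab}}$. $(L\star L,\alpha_\star)$ is the Hom-Lie algebra generated by symbols $l\star l'$ ($l,l'\in L$), bilinear in $l,l'$ over $\mathbb F$, subject to $[m,m']\star\alpha_L(n)=\alpha_L(m)\star[m',n]-\alpha_L(m')\star[m,n]$, $\ \alpha_L(m)\star[n,n']=[n',m]\star\alpha_L(n)-[n,m]\star\alpha_L(n')$, $\ [m\star n,m'\star n']=-[n,m]\star[m',n']$,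 for all $m,m',n,n'\in L$, with $\alpha_\star(m\star n)=\alpha_L(m)\star\alpha_L(n)$. Let $L\square L$ be the subspace spanned by all $x\star x$, $x\in L$ (it is a central ideal). Then $(L\curlywedge L,\alpha_\curlywedge)=(L\star L)/(L\square L)$ with the induced map. Universal quadratic Hom-functor: for a Hom-vector space $(A,\alpha_A)$, $\Gamma(A)$ is the $\mathbb F$-vector space generated by symbols $\gamma(a)$, $a\in A$, subject to, for all $\lambda\in\mathbb F$, $a,b,c\in A$: $\lambda^2\gamma(a)=\gamma(\lambda a)$; $\gamma(\lambda a+b)+\lambda\gamma(a)+\lambda\gamma(b)=\lambda\gamma(a+b)+\gamma(\lambda a)+\gamma(b)$; $\gamma(a+b+c)+\gamma(a)+\gamma(b)+\gamma(c)=\gamma(a+b)+\gamma(a+c)+\gamma(b+c)$; and $\alpha_\Gamma(\gamma(a))=\gamma(\alpha_A(a))$.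
   Formalization: The product of L⋆L is also required to be alternating, [t,t]=0. This follows from skew-symmetry unless char F = 2, where the claim fails without it (e.g. over F_2, [e_i,e_j]=e_k, [e_i,e_i]=0, α=id: L^ab=0 but e_1⋆e_1≠0). *)

theory Defs
  imports "HOL-Algebra.Algebraic_Closure_Type" "HOL-Algebra.Module" "HOL-Library.Poly_Mapping"
begin

section \<open>Hom-Lie algebras\<close>

text \<open>
  The ground field is a type of class \<open>field\<close>, and vector spaces over it are modules in the sense of
  HOL-Algebra.  The fields \<open>mult\<close> and \<open>one\<close> that \<open>module\<close> inherits from \<open>ring\<close> play no role (the
  locale \<open>module\<close> does not constrain them) and are left undefined in the constructions below; the
  Lie product is the separate field \<open>bracket\<close>.
\<close>

abbreviation scalars :: "'f::field ring"
  where "scalars \<equiv> ring_of_type_algebra"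

record ('f, 'v) hom_alg = "('f, 'v) module" +
  bracket :: "'v \<Rightarrow> 'v \<Rightarrow> 'v"
  twist :: "'v \<Rightarrow> 'v"

locale hom_vector_space = module scalars V
  for V :: "('f::field, 'v) hom_alg" (structure) +
  assumes twist_closed: "x \<in> carrier V \<Longrightarrow> twist V x \<in> carrier V"
    and twist_add: "\<lbrakk>x \<in> carrier V; y \<in> carrier V\<rbrakk> \<Longrightarrow> twist V (x \<oplus> y) = twist V x \<oplus> twist V y"
    and twist_smult: "x \<in> carrier V \<Longrightarrow> twist V (c \<odot> x) = c \<odot> twist V x"

locale hom_lie_algebra = hom_vector_space L
  for L :: "('f::field, 'v) hom_alg" (structure) +
  assumes bracket_closed:
      "\<lbrakk>x \<in> carrier L; y \<in> carrier L\<rbrakk> \<Longrightarrow> bracket L x y \<in> carrier L"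
    and bracket_add_left:
      "\<lbrakk>x \<in> carrier L; y \<in> carrier L; z \<in> carrier L\<rbrakk> \<Longrightarrow>
        bracket L (x \<oplus> y) z = bracket L x z \<oplus> bracket L y z"
    and bracket_add_right:
      "\<lbrakk>x \<in> carrier L; y \<in> carrier L; z \<in> carrier L\<rbrakk> \<Longrightarrow>
        bracket L x (y \<oplus> z) = bracket L x y \<oplus> bracket L x z"
    and bracket_smult_left:
      "\<lbrakk>x \<in> carrier L; y \<in> carrier L\<rbrakk> \<Longrightarrow> bracket L (c \<odot> x) y = c \<odot> bracket L x y"
    and bracket_smult_right:
      "\<lbrakk>x \<in> carrier L; y \<in> carrier L\<rbrakk> \<Longrightarrow> bracket L x (c \<odot> y) = c \<odot> bracket L x y"
    and bracket_skew:
      "\<lbrakk>x \<in> carrier L; y \<in> carrier L\<rbrakk> \<Longrightarrow> bracket L x y = \<ominus> bracket L y x"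
    and hom_jacobi:
      "\<lbrakk>x \<in> carrier L; y \<in> carrier L; z \<in> carrier L\<rbrakk> \<Longrightarrow>
        bracket L (twist L x) (bracket L y z) \<oplus> bracket L (twist L y) (bracket L z x)
          \<oplus> bracket L (twist L z) (bracket L x y) = \<zero>"
    and twist_bracket:
      "\<lbrakk>x \<in> carrier L; y \<in> carrier L\<rbrakk> \<Longrightarrow>
        twist L (bracket L x y) = bracket L (twist L x) (twist L y)"

definition hom_lie_hom :: "('f::field, 'v) hom_alg \<Rightarrow> ('f, 'w) hom_alg \<Rightarrow> ('v \<Rightarrow> 'w) set"
  where "hom_lie_hom L M = {f \<in> carrier L \<rightarrow> carrier M.
    (\<forall>x\<in>carrier L. \<forall>y\<in>carrier L. f (x \<oplus>\<^bsub>L\<^esub> y) = f x \<oplus>\<^bsub>M\<^esub> f y) \<and>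
    (\<forall>c. \<forall>x\<in>carrier L. f (c \<odot>\<^bsub>L\<^esub> x) = c \<odot>\<^bsub>M\<^esub> f x) \<and>
    (\<forall>x\<in>carrier L. \<forall>y\<in>carrier L. f (bracket L x y) = bracket M (f x) (f y)) \<and>
    (\<forall>x\<in>carrier L. f (twist L x) = twist M (f x))}"

definition short_exact ::
  "('f::field, 'u) hom_alg \<Rightarrow> ('u \<Rightarrow> 'v) \<Rightarrow> ('f, 'v) hom_alg \<Rightarrow> ('v \<Rightarrow> 'w) \<Rightarrow> ('f, 'w) hom_alg \<Rightarrow> bool"
  where "short_exact A i B p C \<longleftrightarrow>
    hom_lie_algebra A \<and> hom_lie_algebra B \<and> hom_lie_algebra C \<and>
    i \<in> hom_lie_hom A B \<and> p \<in> hom_lie_hom B C \<and>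
    inj_on i (carrier A) \<and> i ` carrier A = a_kernel B C p \<and> p ` carrier B = carrier C"


section \<open>Subspaces, quotients, abelianization\<close>

definition lin_span :: "('f::field, 'v) hom_alg \<Rightarrow> 'v set \<Rightarrow> 'v set"
  where "lin_span V S = (\<lambda>H. submodule H scalars V) hull S"

text \<open>
  The operations on cosets follow \<open>FactRing\<close>.  They are meaningful when \<open>I\<close> is a subspace stable under
  \<open>twist\<close> and an ideal for \<open>bracket\<close>.
\<close>

definition hom_quot :: "('f::field, 'v) hom_alg \<Rightarrow> 'v set \<Rightarrow> ('f, 'v set) hom_alg"
  where "hom_quot L I = \<lparr>
    carrier = a_rcosets\<^bsub>L\<^esub> I,
    monoid.mult = undefined,
    one = undefined,
    ring.zero = I,
    add = set_add L,
    module.smult = (\<lambda>c A. \<Union>a\<in>A. I +>\<^bsub>L\<^esub> (c \<odot>\<^bsub>L\<^esub> a)),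
    bracket = (\<lambda>A B. \<Union>a\<in>A. \<Union>b\<in>B. I +>\<^bsub>L\<^esub> bracket L a b),
    twist = (\<lambda>A. \<Union>a\<in>A. I +>\<^bsub>L\<^esub> twist L a)\<rparr>"

definition derived_ideal :: "('f::field, 'v) hom_alg \<Rightarrow> 'v set"
  where "derived_ideal L = lin_span L {bracket L x y | x y. x \<in> carrier L \<and> y \<in> carrier L}"

definition abelianization :: "('f::field, 'v) hom_alg \<Rightarrow> ('f, 'v set) hom_alg"
  where "abelianization L = hom_quot L (derived_ideal L)"

definition ab_class :: "('f::field, 'v) hom_alg \<Rightarrow> 'v \<Rightarrow> 'v set"
  where "ab_class L x = derived_ideal L +>\<^bsub>L\<^esub> x"


section \<open>The universal quadratic functor\<close>

text \<open>
  The free vector space on \<open>S\<close>, with zero product and with the linear extension of \<open>f : S \<rightarrow> S\<close> as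
  structure map.
\<close>

definition free_hom_vs :: "'v set \<Rightarrow> ('v \<Rightarrow> 'v) \<Rightarrow> ('f::field, 'v \<Rightarrow>\<^sub>0 'f) hom_alg"
  where "free_hom_vs S f = \<lparr>
    carrier = {p. Poly_Mapping.keys p \<subseteq> S},
    monoid.mult = undefined,
    one = undefined,
    ring.zero = 0,
    add = (+),
    module.smult = (\<lambda>c. Poly_Mapping.map ((*) c)),
    bracket = (\<lambda>_ _. 0),
    twist = (\<lambda>p. \<Sum>x\<in>Poly_Mapping.keys p.
      Poly_Mapping.single (f x) (Poly_Mapping.lookup p x))\<rparr>"

text \<open>
  Here \<open>single a c\<close> is the multiple \<open>c \<gamma>(a)\<close> of the free generator at \<open>a\<close>; each relation is listed as
  left-hand side minus right-hand side.
\<close>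

definition gamma_relators :: "('f::field, 'v) hom_alg \<Rightarrow> ('v \<Rightarrow>\<^sub>0 'f) set"
  where "gamma_relators A =
    {Poly_Mapping.single a (c^2) - Poly_Mapping.single (c \<odot>\<^bsub>A\<^esub> a) 1 | c a. a \<in> carrier A} \<union>
    {(Poly_Mapping.single (c \<odot>\<^bsub>A\<^esub> a \<oplus>\<^bsub>A\<^esub> b) 1 + Poly_Mapping.single a c + Poly_Mapping.single b c)
      - (Poly_Mapping.single (a \<oplus>\<^bsub>A\<^esub> b) c + Poly_Mapping.single (c \<odot>\<^bsub>A\<^esub> a) 1 + Poly_Mapping.single b 1)
      | c a b. a \<in> carrier A \<and> b \<in> carrier A} \<union>
    {(Poly_Mapping.single (a \<oplus>\<^bsub>A\<^esub> b \<oplus>\<^bsub>A\<^esub> c) 1 + Poly_Mapping.single a 1 + Poly_Mapping.single b 1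
        + Poly_Mapping.single c 1)
      - (Poly_Mapping.single (a \<oplus>\<^bsub>A\<^esub> b) 1 + Poly_Mapping.single (a \<oplus>\<^bsub>A\<^esub> c) 1
        + Poly_Mapping.single (b \<oplus>\<^bsub>A\<^esub> c) 1)
      | a b c. a \<in> carrier A \<and> b \<in> carrier A \<and> c \<in> carrier A}"

definition gamma_ideal :: "('f::field, 'v) hom_alg \<Rightarrow> ('v \<Rightarrow>\<^sub>0 'f) set"
  where "gamma_ideal A = lin_span (free_hom_vs (carrier A) (twist A)) (gamma_relators A)"

definition Gamma :: "('f::field, 'v) hom_alg \<Rightarrow> ('f, ('v \<Rightarrow>\<^sub>0 'f) set) hom_alg"
  where "Gamma A = hom_quot (free_hom_vs (carrier A) (twist A)) (gamma_ideal A)"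

definition gamma :: "('f::field, 'v) hom_alg \<Rightarrow> 'v \<Rightarrow> ('v \<Rightarrow>\<^sub>0 'f) set"
  where "gamma A a =
    gamma_ideal A +>\<^bsub>free_hom_vs (carrier A) (twist A)\<^esub> Poly_Mapping.single a 1"


section \<open>Hom-Lie algebras given by generators and relations\<close>

datatype (dead 'f, gens: 'g) hl_term =
    Gen 'g
  | Zero
  | Add "('f, 'g) hl_term" "('f, 'g) hl_term"
  | Smult 'f "('f, 'g) hl_term"
  | Bracket "('f, 'g) hl_term" "('f, 'g) hl_term"
  | Twist "('f, 'g) hl_term"

text \<open>
  The least congruence containing the relations \<open>R\<close> whose quotient is a Hom-Lie algebra with
  alternating product.

  The rule \<open>alternating\<close> follows from \<open>skew\<close> unless the characteristic is 2.  In characteristic 2 it is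
  the usual requirement on a Lie product, and it cannot be dropped: for
  \<open>L = \<langle>e\<^sub>1, e\<^sub>2, e\<^sub>3\<rangle>\<close> with \<open>[e\<^sub>i, e\<^sub>j] = e\<^sub>k\<close> for \<open>{i, j, k} = {1, 2, 3}\<close>, \<open>[e\<^sub>i, e\<^sub>i] = 0\<close> and identity
  structure map one has \<open>L\<^sup>a\<^sup>b = 0\<close>, while \<open>e\<^sub>1 \<star> e\<^sub>1\<close> is nonzero in the algebra presented without this
  rule: \<open>x \<star> y \<mapsto> [x, y]\<close>, with the product of the central extension of \<open>L\<close> by \<open>c\<close> given by
  \<open>[e\<^sub>i, e\<^sub>j] = e\<^sub>k\<close>, \<open>[e\<^sub>1, e\<^sub>1] = [e\<^sub>2, e\<^sub>2] = c\<close>, \<open>[e\<^sub>3, e\<^sub>3] = 0\<close>, respects all the other rules and sends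
  \<open>e\<^sub>1 \<star> e\<^sub>1\<close> to \<open>c\<close>.
\<close>

inductive hl_cong ::
  "(('f::field, 'g) hl_term \<Rightarrow> ('f, 'g) hl_term \<Rightarrow> bool) \<Rightarrow> ('f, 'g) hl_term \<Rightarrow> ('f, 'g) hl_term \<Rightarrow> bool"
  for R
  where
    relation: "R s t \<Longrightarrow> hl_cong R s t"
  | refl: "hl_cong R s s"
  | sym: "hl_cong R s t \<Longrightarrow> hl_cong R t s"
  | trans: "hl_cong R s t \<Longrightarrow> hl_cong R t u \<Longrightarrow> hl_cong R s u"
  | cong_Add: "hl_cong R s s' \<Longrightarrow> hl_cong R t t' \<Longrightarrow> hl_cong R (Add s t) (Add s' t')"
  | cong_Smult: "hl_cong R s s' \<Longrightarrow> hl_cong R (Smult c s) (Smult c s')"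
  | cong_Bracket: "hl_cong R s s' \<Longrightarrow> hl_cong R t t' \<Longrightarrow> hl_cong R (Bracket s t) (Bracket s' t')"
  | cong_Twist: "hl_cong R s s' \<Longrightarrow> hl_cong R (Twist s) (Twist s')"
  | add_assoc: "hl_cong R (Add (Add s t) u) (Add s (Add t u))"
  | add_comm: "hl_cong R (Add s t) (Add t s)"
  | add_zero: "hl_cong R (Add Zero s) s"
  | add_neg: "hl_cong R (Add s (Smult (-1) s)) Zero"
  | smult_add_left: "hl_cong R (Smult (c + d) s) (Add (Smult c s) (Smult d s))"
  | smult_add_right: "hl_cong R (Smult c (Add s t)) (Add (Smult c s) (Smult c t))"
  | smult_assoc: "hl_cong R (Smult (c * d) s) (Smult c (Smult d s))"
  | smult_one: "hl_cong R (Smult 1 s) s"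
  | bracket_add_left: "hl_cong R (Bracket (Add s t) u) (Add (Bracket s u) (Bracket t u))"
  | bracket_add_right: "hl_cong R (Bracket s (Add t u)) (Add (Bracket s t) (Bracket s u))"
  | bracket_smult_left: "hl_cong R (Bracket (Smult c s) t) (Smult c (Bracket s t))"
  | bracket_smult_right: "hl_cong R (Bracket s (Smult c t)) (Smult c (Bracket s t))"
  | skew: "hl_cong R (Bracket s t) (Smult (-1) (Bracket t s))"
  | alternating: "hl_cong R (Bracket s s) Zero"
  | jacobi: "hl_cong R (Add (Add (Bracket (Twist s) (Bracket t u)) (Bracket (Twist t) (Bracket u s)))
      (Bracket (Twist u) (Bracket s t))) Zero"
  | twist_add: "hl_cong R (Twist (Add s t)) (Add (Twist s) (Twist t))"
  | twist_smult: "hl_cong R (Twist (Smult c s)) (Smult c (Twist s))"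
  | twist_bracket: "hl_cong R (Twist (Bracket s t)) (Bracket (Twist s) (Twist t))"

text \<open>
  The Hom-Lie algebra generated by the symbols in \<open>S\<close> subject to \<open>R\<close>; here \<open>R\<close> should only relate terms
  over \<open>S\<close>, and the elements are the congruence classes of such terms.
\<close>

definition hl_class ::
  "'g set \<Rightarrow> (('f::field, 'g) hl_term \<Rightarrow> ('f, 'g) hl_term \<Rightarrow> bool) \<Rightarrow> ('f, 'g) hl_term \<Rightarrow> ('f, 'g) hl_term set"
  where "hl_class S R s = {t. gens t \<subseteq> S \<and> hl_cong R s t}"

definition presented ::
  "'g set \<Rightarrow> (('f::field, 'g) hl_term \<Rightarrow> ('f, 'g) hl_term \<Rightarrow> bool) \<Rightarrow> ('f, ('f, 'g) hl_term set) hom_alg"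
  where "presented S R = \<lparr>
    carrier = hl_class S R ` {t. gens t \<subseteq> S},
    monoid.mult = undefined,
    one = undefined,
    ring.zero = hl_class S R Zero,
    add = (\<lambda>A B. \<Union>s\<in>A. \<Union>t\<in>B. hl_class S R (Add s t)),
    module.smult = (\<lambda>c A. \<Union>s\<in>A. hl_class S R (Smult c s)),
    bracket = (\<lambda>A B. \<Union>s\<in>A. \<Union>t\<in>B. hl_class S R (Bracket s t)),
    twist = (\<lambda>A. \<Union>s\<in>A. hl_class S R (Twist s))\<rparr>"


section \<open>The non-abelian tensor and exterior squares\<close>

abbreviation Sub :: "('f::field, 'g) hl_term \<Rightarrow> ('f, 'g) hl_term \<Rightarrow> ('f, 'g) hl_term"
  where "Sub s t \<equiv> Add s (Smult (-1) t)"

abbreviation Star :: "'v \<Rightarrow> 'v \<Rightarrow> ('f, 'v \<times> 'v) hl_term"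
  where "Star l l' \<equiv> Gen (l, l')"

inductive star_rel ::
  "('f::field, 'v) hom_alg \<Rightarrow> ('f, 'v \<times> 'v) hl_term \<Rightarrow> ('f, 'v \<times> 'v) hl_term \<Rightarrow> bool"
  for L (structure)
  where
    star_add_left: "\<lbrakk>l \<in> carrier L; m \<in> carrier L; n \<in> carrier L\<rbrakk> \<Longrightarrow>
      star_rel L (Star (l \<oplus> m) n) (Add (Star l n) (Star m n))"
  | star_add_right: "\<lbrakk>l \<in> carrier L; m \<in> carrier L; n \<in> carrier L\<rbrakk> \<Longrightarrow>
      star_rel L (Star l (m \<oplus> n)) (Add (Star l m) (Star l n))"
  | star_smult_left: "\<lbrakk>l \<in> carrier L; m \<in> carrier L\<rbrakk> \<Longrightarrow>
      star_rel L (Star (c \<odot> l) m) (Smult c (Star l m))"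
  | star_smult_right: "\<lbrakk>l \<in> carrier L; m \<in> carrier L\<rbrakk> \<Longrightarrow>
      star_rel L (Star l (c \<odot> m)) (Smult c (Star l m))"
  | bracket_left: "\<lbrakk>m \<in> carrier L; m' \<in> carrier L; n \<in> carrier L\<rbrakk> \<Longrightarrow>
      star_rel L (Star (bracket L m m') (twist L n))
        (Sub (Star (twist L m) (bracket L m' n)) (Star (twist L m') (bracket L m n)))"
  | bracket_right: "\<lbrakk>m \<in> carrier L; n \<in> carrier L; n' \<in> carrier L\<rbrakk> \<Longrightarrow>
      star_rel L (Star (twist L m) (bracket L n n'))
        (Sub (Star (bracket L n' m) (twist L n)) (Star (bracket L n m) (twist L n')))"
  | bracket_star: "\<lbrakk>m \<in> carrier L; n \<in> carrier L; m' \<in> carrier L; n' \<in> carrier L\<rbrakk> \<Longrightarrow>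
      star_rel L (Bracket (Star m n) (Star m' n'))
        (Smult (-1) (Star (bracket L n m) (bracket L m' n')))"
  | twist_star: "\<lbrakk>m \<in> carrier L; n \<in> carrier L\<rbrakk> \<Longrightarrow>
      star_rel L (Twist (Star m n)) (Star (twist L m) (twist L n))"

definition tensor_square ::
  "('f::field, 'v) hom_alg \<Rightarrow> ('f, ('f, 'v \<times> 'v) hl_term set) hom_alg"
  where "tensor_square L = presented (carrier L \<times> carrier L) (star_rel L)"

definition star :: "('f::field, 'v) hom_alg \<Rightarrow> 'v \<Rightarrow> 'v \<Rightarrow> ('f, 'v \<times> 'v) hl_term set"
  where "star L x y = hl_class (carrier L \<times> carrier L) (star_rel L) (Star x y)"

definition square_ideal :: "('f::field, 'v) hom_alg \<Rightarrow> ('f, 'v \<times> 'v) hl_term set set"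
  where "square_ideal L = lin_span (tensor_square L) {star L x x | x. x \<in> carrier L}"

definition exterior_square ::
  "('f::field, 'v) hom_alg \<Rightarrow> ('f, ('f, 'v \<times> 'v) hl_term set set) hom_alg"
  where "exterior_square L = hom_quot (tensor_square L) (square_ideal L)"

definition exterior_proj ::
  "('f::field, 'v) hom_alg \<Rightarrow> ('f, 'v \<times> 'v) hl_term set \<Rightarrow> ('f, 'v \<times> 'v) hl_term set set"
  where "exterior_proj L t = square_ideal L +>\<^bsub>tensor_square L\<^esub> t"

end

theory Submission
  imports Defs
begin

text \<open>
  Write \<open>F x y z = \<alpha> x \<star> [y, z]\<close> and \<open>G x y z = [y, z] \<star> \<alpha> x\<close>.  The two families of relations say that \<open>G\<close> is the
  sum of the two other cyclic permutations of \<open>F\<close> and conversely, so the cyclic sum of \<open>F\<close> vanishes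
  and \<open>G = - F\<close>.  As \<open>\<alpha>\<close> is surjective, \<open>x \<star> d + d \<star> x = 0\<close> for \<open>d\<close> in the derived ideal; together with
  \<open>d \<star> d = 0\<close>, which comes from the alternating product, \<open>x \<star> x\<close> depends only on the class of \<open>x\<close>.
  Since also \<open>[x, x] \<star> y = 0\<close>, the elements \<open>x \<star> x\<close> are central, and \<open>\<gamma>(x) \<mapsto> x \<star> x\<close> defines a
  homomorphism with image \<open>L \<square> L\<close>.

  For injectivity, every pair of functionals \<open>f\<close>, \<open>g\<close> on the abelianization extends to the functional
  \<open>x \<star> y \<mapsto> f(x) g(y)\<close> on \<open>L \<star> L\<close>.  So if \<open>\<Sum> c\<^sub>i x\<^sub>i \<star> x\<^sub>i = 0\<close>, then \<open>\<Sum> c\<^sub>i f(x\<^sub>i) g(x\<^sub>i) = 0\<close> for all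
  \<open>f\<close> and \<open>g\<close>; expanding in a basis gives \<open>\<Sum> c\<^sub>i q(x\<^sub>i) = 0\<close> for every quadratic form \<open>q\<close>, and the linear
  functionals on \<open>\<Gamma>\<close> are exactly the quadratic forms.
\<close>

section \<open>Hom-vector spaces and Hom-Lie algebras\<close>

lemma scalars_simps [simp]:
  "carrier scalars = UNIV"
  "add scalars = (+)"
  "monoid.mult scalars = (*)"
  "one scalars = 1"
  "zero scalars = 0"
  by (simp_all add: ring_of_type_algebra_def)

lemma a_inv_scalars [simp]: "a_inv scalars x = - x"
proof -
  interpret cring "scalars :: 'a ring" by (rule cring_from_type_algebra)
  show ?thesis
    using minus_equality[of "- x" x] by simp
qed

lemma (in hom_vector_space)
  shows scale_closed [simp]: "x \<in> carrier V \<Longrightarrow> c \<odot> x \<in> carrier V"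
    and smult_add_left: "x \<in> carrier V \<Longrightarrow> (c + d) \<odot> x = c \<odot> x \<oplus> d \<odot> x"
    and smult_add_right: "\<lbrakk>x \<in> carrier V; y \<in> carrier V\<rbrakk> \<Longrightarrow> c \<odot> (x \<oplus> y) = c \<odot> x \<oplus> c \<odot> y"
    and smult_smult: "x \<in> carrier V \<Longrightarrow> c \<odot> (d \<odot> x) = (c * d) \<odot> x"
    and smult_1 [simp]: "x \<in> carrier V \<Longrightarrow> 1 \<odot> x = x"
    and smult_0 [simp]: "x \<in> carrier V \<Longrightarrow> 0 \<odot> x = \<zero>"
    and smult_zero [simp]: "c \<odot> \<zero> = \<zero>"
    and smult_minus_1: "x \<in> carrier V \<Longrightarrow> (- 1) \<odot> x = \<ominus> x"
proof -
  show "x \<in> carrier V \<Longrightarrow> c \<odot> (d \<odot> x) = (c * d) \<odot> x"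
    using smult_assoc1[of c d x] by simp
qed (use smult_l_distr[of c d x] smult_r_distr[of c x y] smult_one[of x]
    smult_l_null[of x] smult_r_null[of c] smult_l_minus[of 1 x] in simp_all)

lemma (in hom_vector_space) twist_zero [simp]: "twist V \<zero> = \<zero>"
  using twist_smult[of \<zero> 0] twist_closed[of \<zero>] by simp

text \<open>Additive inverses are required in the form
  \<open>(- 1) \<odot> x \<oplus> x = \<zero>\<close>, so that apart from closure every condition is
  an equation between given operations and can be transported along a map.\<close>

lemma hom_vector_spaceI:
  fixes V :: "('f::field, 'v) hom_alg" (structure)
  assumes "\<And>x y. \<lbrakk>x \<in> carrier V; y \<in> carrier V\<rbrakk> \<Longrightarrow> x \<oplus> y \<in> carrier V"
    and "\<zero> \<in> carrier V"
    and "\<And>x y z. \<lbrakk>x \<in> carrier V; y \<in> carrier V; z \<in> carrier V\<rbrakk> \<Longrightarrow> (x \<oplus> y) \<oplus> z = x \<oplus> (y \<oplus> z)"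
    and "\<And>x y. \<lbrakk>x \<in> carrier V; y \<in> carrier V\<rbrakk> \<Longrightarrow> x \<oplus> y = y \<oplus> x"
    and "\<And>x. x \<in> carrier V \<Longrightarrow> \<zero> \<oplus> x = x"
    and "\<And>x. x \<in> carrier V \<Longrightarrow> (- 1) \<odot> x \<oplus> x = \<zero>"
    and "\<And>c x. x \<in> carrier V \<Longrightarrow> c \<odot> x \<in> carrier V"
    and "\<And>c d x. x \<in> carrier V \<Longrightarrow> (c + d) \<odot> x = c \<odot> x \<oplus> d \<odot> x"
    and "\<And>c x y. \<lbrakk>x \<in> carrier V; y \<in> carrier V\<rbrakk> \<Longrightarrow> c \<odot> (x \<oplus> y) = c \<odot> x \<oplus> c \<odot> y"
    and "\<And>c d x. x \<in> carrier V \<Longrightarrow> (c * d) \<odot> x = c \<odot> (d \<odot> x)"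
    and "\<And>x. x \<in> carrier V \<Longrightarrow> 1 \<odot> x = x"
    and "\<And>x. x \<in> carrier V \<Longrightarrow> twist V x \<in> carrier V"
    and "\<And>x y. \<lbrakk>x \<in> carrier V; y \<in> carrier V\<rbrakk> \<Longrightarrow> twist V (x \<oplus> y) = twist V x \<oplus> twist V y"
    and "\<And>c x. x \<in> carrier V \<Longrightarrow> twist V (c \<odot> x) = c \<odot> twist V x"
  shows "hom_vector_space V"
proof -
  have "abelian_group V"
  proof (rule abelian_groupI)
    show "\<exists>y\<in>carrier V. y \<oplus> x = \<zero>" if "x \<in> carrier V" for x
      using assms(6)[OF that] assms(7)[OF that] by blast
  qed fact+
  then have "module scalars V"
    by (intro moduleI) (simp_all add: assms(7-11) cring_from_type_algebra)
  then show ?thesis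
    by (rule hom_vector_space.intro) (rule hom_vector_space_axioms.intro, fact+)
qed

lemma hom_lie_homD:
  assumes "f \<in> hom_lie_hom V W"
  shows "x \<in> carrier V \<Longrightarrow> f x \<in> carrier W"
    and "\<lbrakk>x \<in> carrier V; y \<in> carrier V\<rbrakk> \<Longrightarrow> f (x \<oplus>\<^bsub>V\<^esub> y) = f x \<oplus>\<^bsub>W\<^esub> f y"
    and "x \<in> carrier V \<Longrightarrow> f (c \<odot>\<^bsub>V\<^esub> x) = c \<odot>\<^bsub>W\<^esub> f x"
    and "\<lbrakk>x \<in> carrier V; y \<in> carrier V\<rbrakk> \<Longrightarrow> f (bracket V x y) = bracket W (f x) (f y)"
    and "x \<in> carrier V \<Longrightarrow> f (twist V x) = twist W (f x)"
  using assms by (auto simp: hom_lie_hom_def)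

text \<open>All axioms are identities, so they pass to the image of a map that preserves the
  operations. Nothing is known about \<open>W\<close> beforehand, not even that it is a group, so
  the image of zero has to be prescribed separately.\<close>

lemma hom_lie_algebra_image:
  fixes V :: "('f::field, 'v) hom_alg" and W :: "('f, 'w) hom_alg"
  assumes "hom_lie_algebra V" and p: "p \<in> hom_lie_hom V W"
    and img: "carrier W = p ` carrier V" and zero: "p \<zero>\<^bsub>V\<^esub> = \<zero>\<^bsub>W\<^esub>"
  shows "hom_lie_algebra W"
proof -
  interpret V: hom_lie_algebra V by fact
  note h = hom_lie_homD(2-)[OF p, symmetric]
  have m: "(- 1) \<odot>\<^bsub>V\<^esub> x \<oplus>\<^bsub>V\<^esub> x = \<zero>\<^bsub>V\<^esub>" if "x \<in> carrier V" for x
    using that by (simp add: V.smult_minus_1 V.l_neg)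
  have comm: "p (x \<oplus>\<^bsub>V\<^esub> y) = p (y \<oplus>\<^bsub>V\<^esub> x)" if "x \<in> carrier V" "y \<in> carrier V" for x y
    using V.a_comm[OF that] by simp
  have skew: "p (bracket V x y) = p (\<ominus>\<^bsub>V\<^esub> bracket V y x)" if "x \<in> carrier V" "y \<in> carrier V" for x y
    using V.bracket_skew[OF that] by simp
  have W: "hom_vector_space W"
    by (rule hom_vector_spaceI, unfold img zero[symmetric])
      (auto simp: h m V.add.m_assoc V.smult_add_left V.smult_add_right V.smult_smult
        V.twist_closed V.twist_add V.twist_smult intro: comm)
  \<comment> \<open>Negation is not among the operations that \<open>p\<close> preserves by
    definition; it becomes available as multiplication by -1 once \<open>W\<close> is a
    module.\<close>
  have neg: "\<ominus>\<^bsub>W\<^esub> p x = p (\<ominus>\<^bsub>V\<^esub> x)" if "x \<in> carrier V" for x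
    using that hom_vector_space.smult_minus_1[OF W, of "p x"] by (simp add: img h V.smult_minus_1)
  show ?thesis
  proof (rule hom_lie_algebra.intro[OF W], rule hom_lie_algebra_axioms.intro, unfold img zero[symmetric], goal_cases)
    case (6 x y)
    then show ?case by (auto simp: h neg V.bracket_closed intro: skew)
  next
    case (7 x y z)
    then show ?case by (auto simp: h V.bracket_closed V.twist_closed V.hom_jacobi)
  next
    case (8 x y)
    then show ?case by (auto simp: h V.bracket_closed V.twist_closed V.twist_bracket)
  qed (force simp: h V.bracket_closed V.bracket_add_left V.bracket_add_right
        V.bracket_smult_left V.bracket_smult_right)+
qed

section \<open>Spans\<close>

context hom_vector_space
begin

lemma submoduleI':
  assumes "H \<subseteq> carrier V" and "\<zero> \<in> H" and "\<And>x y. \<lbrakk>x \<in> H; y \<in> H\<rbrakk> \<Longrightarrow> x \<oplus> y \<in> H"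
    and "\<And>c x. x \<in> H \<Longrightarrow> c \<odot> x \<in> H"
  shows "submodule H scalars V"
proof (rule submoduleI)
  show "\<ominus> a \<in> H" if "a \<in> H" for a
    using assms(4)[OF that, of "- 1"] that assms(1) smult_minus_1[of a] by auto
qed (use assms in auto)

lemma submodule_zero: "submodule H scalars V \<Longrightarrow> \<zero> \<in> H"
  using subgroup.one_closed[OF submodule.axioms(1), of H scalars V] by simp

lemma lin_span_submodule:
  assumes "S \<subseteq> carrier V"
  shows "submodule (lin_span V S) scalars V"
proof (rule submoduleI')
  let ?H = "{H. submodule H scalars V \<and> S \<subseteq> H}"
  have eq: "lin_span V S = \<Inter> ?H"
    by (simp add: lin_span_def hull_def)
  show "lin_span V S \<subseteq> carrier V"
    using assms carrier_is_submodule by (auto simp: eq)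
  show "\<zero> \<in> lin_span V S"
    by (auto simp: eq submodule_zero)
  show "x \<oplus> y \<in> lin_span V S" if "x \<in> lin_span V S" "y \<in> lin_span V S" for x y
    using that by (auto simp: eq submoduleE(5))
  show "c \<odot> x \<in> lin_span V S" if "x \<in> lin_span V S" for c x
    using that by (auto simp: eq submoduleE(4))
qed

lemma lin_span_superset: "S \<subseteq> lin_span V S"
  by (simp add: lin_span_def hull_subset)

lemma lin_span_minimal:
  assumes "S \<subseteq> H" and "submodule H scalars V"
  shows "lin_span V S \<subseteq> H"
  using assms by (simp add: lin_span_def hull_minimal)

text \<open>The elements of the carrier that the linear map \<open>f\<close> sends into
  \<open>H\<close> form a submodule, and it contains \<open>S\<close>.\<close>

lemma lin_span_stable:
  assumes S: "S \<subseteq> carrier V" and H: "submodule H scalars V"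
    and f: "\<And>x. x \<in> carrier V \<Longrightarrow> f x \<in> carrier V" "f \<zero> = \<zero>"
      "\<And>x y. \<lbrakk>x \<in> carrier V; y \<in> carrier V\<rbrakk> \<Longrightarrow> f (x \<oplus> y) = f x \<oplus> f y"
      "\<And>c x. x \<in> carrier V \<Longrightarrow> f (c \<odot> x) = c \<odot> f x"
    and gens: "\<And>x. x \<in> S \<Longrightarrow> f x \<in> H" and x: "x \<in> lin_span V S"
  shows "f x \<in> H"
proof -
  have "lin_span V S \<subseteq> {x \<in> carrier V. f x \<in> H}"
    using S gens submodule_zero[OF H] submoduleE(4,5)[OF H] f
    by (intro lin_span_minimal submoduleI') auto
  then show ?thesis
    using x by auto
qed

end

section \<open>Quotients\<close>

text \<open>Absorption of brackets is asked on one side only; skew symmetry supplies the other side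
  in \<open>bracket_ideal'\<close>.\<close>

locale hom_lie_ideal = hom_lie_algebra L
  for I :: "'v set" and L :: "('f::field, 'v) hom_alg" (structure) +
  assumes is_submodule: "submodule I scalars L"
    and twist_ideal: "x \<in> I \<Longrightarrow> twist L x \<in> I"
    and bracket_ideal: "\<lbrakk>x \<in> carrier L; y \<in> I\<rbrakk> \<Longrightarrow> bracket L x y \<in> I"
begin

sublocale abelian_subgroup I L
proof (rule abelian_subgroupI3)
  show "additive_subgroup I L"
    by (rule additive_subgroup.intro) (rule submodule.axioms(1)[OF is_submodule])
qed unfold_locales

lemma bracket_ideal':
  assumes "x \<in> I" "y \<in> carrier L"
  shows "bracket L x y \<in> I"
  unfolding bracket_skew[OF a_Hcarr[OF assms(1)] assms(2)]
  using assms by (intro a_inv_closed bracket_ideal)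

lemma coset_add_ideal:
  assumes "z \<in> I" "x \<in> carrier L"
  shows "I +> (z \<oplus> x) = I +> x"
  by (metis a_rcos_const a_coset_add_assoc a_subset a_Hcarr assms)

lemma coset_eq_ideal_iff: "x \<in> carrier L \<Longrightarrow> I +> x = I \<longleftrightarrow> x \<in> I"
  by (metis a_rcos_const a_rcos_self)

text \<open>The operations of \<open>hom_quot\<close> are unions over all representatives. If the
  resulting coset does not depend on the representative, the union collapses to its value at any one
  of them.\<close>

lemma UN_coset:
  assumes "x \<in> carrier L" and f: "\<And>z. z \<in> I \<Longrightarrow> I +> f (z \<oplus> x) = I +> f x"
  shows "(\<Union>a\<in>I +> x. I +> f a) = I +> f x"
proof -
  have "I +> f a = I +> f x" if "a \<in> I +> x" for a
  proof -
    obtain z where "z \<in> I" "a = z \<oplus> x"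
      using \<open>a \<in> I +> x\<close> by (auto simp: a_r_coset_def')
    then show ?thesis
      using f by simp
  qed
  then show ?thesis
    using a_rcos_self[OF assms(1)] by blast
qed

lemma hom_quot_carrier: "carrier (hom_quot L I) = (\<lambda>x. I +> x) ` carrier L"
  by (simp add: hom_quot_def A_RCOSETS_def') blast

lemma hom_quot_zero: "\<zero>\<^bsub>hom_quot L I\<^esub> = I +> \<zero>"
  by (simp add: hom_quot_def a_rcos_const)

lemma hom_quot_add:
  "\<lbrakk>x \<in> carrier L; y \<in> carrier L\<rbrakk> \<Longrightarrow> (I +> x) \<oplus>\<^bsub>hom_quot L I\<^esub> (I +> y) = I +> (x \<oplus> y)"
  by (simp add: hom_quot_def a_rcos_sum)

lemma hom_quot_smult:
  "x \<in> carrier L \<Longrightarrow> c \<odot>\<^bsub>hom_quot L I\<^esub> (I +> x) = I +> (c \<odot> x)"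
  unfolding hom_quot_def
  by (simp add: UN_coset smult_add_right coset_add_ideal submoduleE(4)[OF is_submodule] a_Hcarr)

lemma hom_quot_twist:
  "x \<in> carrier L \<Longrightarrow> twist (hom_quot L I) (I +> x) = I +> twist L x"
  unfolding hom_quot_def
  by (simp add: UN_coset twist_add coset_add_ideal twist_ideal twist_closed a_Hcarr)

lemma hom_quot_bracket:
  assumes "x \<in> carrier L" "y \<in> carrier L"
  shows "bracket (hom_quot L I) (I +> x) (I +> y) = I +> bracket L x y"
proof -
  have *: "(\<Union>b\<in>I +> y. I +> bracket L a b) = I +> bracket L a y" if "a \<in> carrier L" for a
    using assms that
    by (intro UN_coset) (simp_all add: bracket_add_right coset_add_ideal bracket_ideal bracket_closed a_Hcarr)
  have "(\<Union>a\<in>I +> x. \<Union>b\<in>I +> y. I +> bracket L a b) = (\<Union>a\<in>I +> x. I +> bracket L a y)"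
    using assms a_r_coset_subset_G[OF a_subset, of x] * by (intro SUP_cong) auto
  also have "\<dots> = I +> bracket L x y"
    using assms
    by (intro UN_coset) (simp_all add: bracket_add_left coset_add_ideal bracket_ideal' bracket_closed a_Hcarr)
  finally show ?thesis
    by (simp add: hom_quot_def)
qed

lemma hom_quot_proj: "(\<lambda>x. I +> x) \<in> hom_lie_hom L (hom_quot L I)"
  by (simp add: hom_lie_hom_def hom_quot_carrier hom_quot_add hom_quot_smult hom_quot_twist
      hom_quot_bracket)

lemma hom_quot_hom_lie_algebra: "hom_lie_algebra (hom_quot L I)"
  by (rule hom_lie_algebra_image[OF hom_lie_algebra_axioms hom_quot_proj])
    (simp_all add: hom_quot_carrier hom_quot_zero)

lemma a_kernel_proj: "a_kernel L (hom_quot L I) (\<lambda>x. I +> x) = I"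
proof -
  have "a_kernel L (hom_quot L I) (\<lambda>x. I +> x) = {x \<in> carrier L. I +> x = I}"
    unfolding a_kernel_def' hom_quot_def by simp
  also have "\<dots> = I"
    using a_subset coset_eq_ideal_iff by blast
  finally show ?thesis .
qed

text \<open>First isomorphism theorem: that \<open>f\<close> kills \<open>I\<close> makes the
  induced map well defined, and that it kills nothing else makes it injective.\<close>

lemma hom_quot_factor:
  fixes W :: "('f, 'w) hom_alg"
  assumes W: "hom_lie_algebra W" and f: "f \<in> hom_lie_hom L W"
    and ker: "\<And>x. x \<in> carrier L \<Longrightarrow> f x = \<zero>\<^bsub>W\<^esub> \<longleftrightarrow> x \<in> I"
  shows "\<exists>g\<in>hom_lie_hom (hom_quot L I) W. inj_on g (carrier (hom_quot L I)) \<and>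
    (\<forall>x\<in>carrier L. g (I +> x) = f x)"
proof -
  interpret W: hom_lie_algebra W by fact
  note f' = hom_lie_homD[OF f]
  \<comment> \<open>The value is read off at an arbitrary element of the coset; any two such
    elements differ by an element of \<open>I\<close>.\<close>
  define g where "g A = f (SOME x. x \<in> A)" for A
  have g: "g (I +> x) = f x" if x: "x \<in> carrier L" for x
  proof -
    have "(SOME y. y \<in> I +> x) \<in> I +> x"
      using a_rcos_self[OF x] by (rule someI)
    then obtain z where "z \<in> I" and z: "(SOME y. y \<in> I +> x) = z \<oplus> x"
      by (auto simp: a_r_coset_def')
    then have "f (z \<oplus> x) = f x"
      using x ker[of z] f' by simp
    then show ?thesis
      by (simp add: g_def z)
  qed
  show ?thesis
  proof (intro bexI conjI ballI)
    show "g \<in> hom_lie_hom (hom_quot L I) W"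
      by (auto simp: hom_lie_hom_def hom_quot_carrier hom_quot_add hom_quot_smult hom_quot_twist
          hom_quot_bracket g f' bracket_closed twist_closed)
    show "inj_on g (carrier (hom_quot L I))"
    proof (rule inj_onI)
      fix A B assume "A \<in> carrier (hom_quot L I)" "B \<in> carrier (hom_quot L I)" and eq: "g A = g B"
      then obtain x y where xy: "A = I +> x" "x \<in> carrier L" "B = I +> y" "y \<in> carrier L"
        by (auto simp: hom_quot_carrier)
      then have "f x \<oplus>\<^bsub>W\<^esub> (- 1) \<odot>\<^bsub>W\<^esub> f y = \<zero>\<^bsub>W\<^esub>"
        using eq by (simp add: g f' W.smult_minus_1 W.r_neg)
      then have "f (x \<oplus> (- 1) \<odot> y) = \<zero>\<^bsub>W\<^esub>"
        using xy by (simp add: f')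
      then have "x \<ominus> y \<in> I"
        using ker xy by (simp add: smult_minus_1 a_minus_def)
      moreover have "(x \<ominus> y) \<oplus> y = x"
        using xy by (simp add: a_minus_def a_assoc l_neg)
      ultimately show "A = B"
        using coset_add_ideal[of "x \<ominus> y" y] xy by simp
    qed
  qed (rule g)
qed

end

section \<open>Free Hom-vector spaces\<close>

abbreviation pm_scale :: "'f::field \<Rightarrow> ('v \<Rightarrow>\<^sub>0 'f) \<Rightarrow> 'v \<Rightarrow>\<^sub>0 'f"
  where "pm_scale c \<equiv> Poly_Mapping.map ((*) c)"

lemma lookup_pm_scale [simp]: "Poly_Mapping.lookup (pm_scale c p) x = c * Poly_Mapping.lookup p x"
  by (simp add: Poly_Mapping.map.rep_eq when_def)

interpretation pm: vector_space "pm_scale :: 'f::field \<Rightarrow> ('v \<Rightarrow>\<^sub>0 'f) \<Rightarrow> _"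
  by unfold_locales (rule poly_mapping_eqI, simp add: lookup_add algebra_simps)+

lemma pm_scale_single [simp]: "pm_scale c (Poly_Mapping.single x d) = Poly_Mapping.single x (c * d)"
  by (rule poly_mapping_eqI) (simp add: lookup_single when_def)

lemma pm_sum_single:
  fixes p :: "'v \<Rightarrow>\<^sub>0 'f::field"
  shows "p = (\<Sum>x\<in>Poly_Mapping.keys p. Poly_Mapping.single x (Poly_Mapping.lookup p x))"
  by (rule poly_mapping_eqI)
    (simp add: lookup_sum lookup_single when_def sum.delta in_keys_iff)

lemma keys_pm_scale: "Poly_Mapping.keys (pm_scale c p) \<subseteq> Poly_Mapping.keys p"
  by (auto simp: in_keys_iff)

lemma keys_pm_add: "\<lbrakk>Poly_Mapping.keys p \<subseteq> S; Poly_Mapping.keys q \<subseteq> S\<rbrakk> \<Longrightarrow> Poly_Mapping.keys (p + q) \<subseteq> S"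
  using keys_add[of p q] by auto

lemma pm_induct [consumes 1, case_names zero single add]:
  fixes p :: "'v \<Rightarrow>\<^sub>0 'f::field"
  assumes "Poly_Mapping.keys p \<subseteq> S" and "P 0"
    and "\<And>x c. x \<in> S \<Longrightarrow> P (Poly_Mapping.single x c)"
    and "\<And>p q. \<lbrakk>Poly_Mapping.keys p \<subseteq> S; Poly_Mapping.keys q \<subseteq> S; P p; P q\<rbrakk> \<Longrightarrow> P (p + q)"
  shows "P p"
proof -
  have "Poly_Mapping.keys (\<Sum>x\<in>K. Poly_Mapping.single x (Poly_Mapping.lookup p x)) \<subseteq> S \<and>
      P (\<Sum>x\<in>K. Poly_Mapping.single x (Poly_Mapping.lookup p x))"
    if "finite K" "K \<subseteq> S" for K
    using that
  proof (induction K rule: finite_induct)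
    case (insert x K)
    moreover have "Poly_Mapping.keys (Poly_Mapping.single x (Poly_Mapping.lookup p x)) \<subseteq> S"
      using insert.prems by simp
    ultimately show ?case
      by (simp add: assms(3,4) keys_pm_add)
  qed (use assms(2) in simp)
  then show ?thesis
    using assms(1) pm_sum_single[of p] by (metis finite_keys)
qed

text \<open>The linear map out of the free vector space that its universal property attaches to the
  values \<open>g\<close> on the generators.\<close>

definition lin_ext :: "('f::field, 'v) hom_alg \<Rightarrow> ('g \<Rightarrow> 'v) \<Rightarrow> ('g \<Rightarrow>\<^sub>0 'f) \<Rightarrow> 'v"
  where "lin_ext V g p = (\<Oplus>\<^bsub>V\<^esub>x\<in>Poly_Mapping.keys p. Poly_Mapping.lookup p x \<odot>\<^bsub>V\<^esub> g x)"

context hom_vector_space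
begin

context
  fixes S :: "'g set" and g :: "'g \<Rightarrow> 'v"
  assumes g: "g \<in> S \<rightarrow> carrier V"
begin

text \<open>Indices outside the support contribute zero. This allows two vectors with different
  supports to be summed over a common index set.\<close>

lemma lin_ext_superset:
  assumes "finite K" "Poly_Mapping.keys p \<subseteq> K" "K \<subseteq> S"
  shows "lin_ext V g p = (\<Oplus>x\<in>K. Poly_Mapping.lookup p x \<odot> g x)"
  unfolding lin_ext_def using assms g
  by (intro add.finprod_mono_neutral_cong_left) (auto simp: in_keys_iff Pi_iff)

lemma lin_ext_closed: "Poly_Mapping.keys p \<subseteq> S \<Longrightarrow> lin_ext V g p \<in> carrier V"
  unfolding lin_ext_def using g by (intro finsum_closed) (auto simp: Pi_iff subset_iff)

lemma lin_ext_0 [simp]: "lin_ext V g 0 = \<zero>"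
  by (simp add: lin_ext_def)

lemma lin_ext_add:
  assumes "Poly_Mapping.keys p \<subseteq> S" "Poly_Mapping.keys q \<subseteq> S"
  shows "lin_ext V g (p + q) = lin_ext V g p \<oplus> lin_ext V g q"
proof -
  let ?K = "Poly_Mapping.keys p \<union> Poly_Mapping.keys q"
  have eq: "lin_ext V g r = (\<Oplus>x\<in>?K. Poly_Mapping.lookup r x \<odot> g x)" if "Poly_Mapping.keys r \<subseteq> ?K" for r
    using that assms by (intro lin_ext_superset) auto
  have gK: "g x \<in> carrier V" if "x \<in> ?K" for x
    using that assms g by auto
  have "lin_ext V g (p + q) =
      (\<Oplus>x\<in>?K. Poly_Mapping.lookup p x \<odot> g x \<oplus> Poly_Mapping.lookup q x \<odot> g x)"
    unfolding eq[OF keys_add] by (rule finsum_cong') (auto simp: lookup_add smult_add_left gK)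
  also have "\<dots> = (\<Oplus>x\<in>?K. Poly_Mapping.lookup p x \<odot> g x) \<oplus> (\<Oplus>x\<in>?K. Poly_Mapping.lookup q x \<odot> g x)"
    by (rule finsum_addf) (auto simp: gK)
  finally show ?thesis
    by (simp add: eq)
qed

lemma lin_ext_smult:
  assumes "Poly_Mapping.keys p \<subseteq> S"
  shows "lin_ext V g (pm_scale c p) = c \<odot> lin_ext V g p"
proof -
  have *: "g x \<in> carrier V" if "x \<in> Poly_Mapping.keys p" for x
    using assms g that by auto
  have "lin_ext V g (pm_scale c p) =
      (\<Oplus>x\<in>Poly_Mapping.keys p. Poly_Mapping.lookup (pm_scale c p) x \<odot> g x)"
    using assms by (intro lin_ext_superset keys_pm_scale) simp_all
  also have "\<dots> = (\<Oplus>x\<in>Poly_Mapping.keys p. c \<odot> (Poly_Mapping.lookup p x \<odot> g x))"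
    by (rule finsum_cong') (simp_all add: * smult_smult Pi_iff)
  also have "\<dots> = c \<odot> lin_ext V g p"
    unfolding lin_ext_def by (rule finsum_smult_ldistr[symmetric]) (simp_all add: * Pi_iff)
  finally show ?thesis .
qed

lemma lin_ext_single [simp]: "x \<in> S \<Longrightarrow> lin_ext V g (Poly_Mapping.single x c) = c \<odot> g x"
proof -
  assume x: "x \<in> S"
  then have gx: "g x \<in> carrier V"
    using g by auto
  have "lin_ext V g (Poly_Mapping.single x c) = (\<Oplus>y\<in>{x}. Poly_Mapping.lookup (Poly_Mapping.single x c) y \<odot> g y)"
    using x by (intro lin_ext_superset) simp_all
  also have "\<dots> = c \<odot> g x"
    using gx by (simp add: finsum_insert)
  finally show ?thesis .
qed

lemma lin_ext_in_submodule:
  assumes "Poly_Mapping.keys p \<subseteq> S" "submodule H scalars V" "g ` S \<subseteq> H"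
  shows "lin_ext V g p \<in> H"
proof -
  have gH: "g x \<in> H" if "x \<in> S" for x
    using assms(3) that by blast
  show ?thesis
    using assms(1)
    by (induction rule: pm_induct)
      (simp_all add: gH submodule_zero lin_ext_add submoduleE(4,5)[OF assms(2)] assms(2))
qed

end
end

lemma free_hom_vs_simps [simp]:
  "carrier (free_hom_vs S f) = {p. Poly_Mapping.keys p \<subseteq> S}"
  "\<zero>\<^bsub>free_hom_vs S f\<^esub> = 0"
  "p \<oplus>\<^bsub>free_hom_vs S f\<^esub> q = p + q"
  "c \<odot>\<^bsub>free_hom_vs S f\<^esub> p = pm_scale c p"
  "bracket (free_hom_vs S f) p q = 0"
  by (simp_all add: free_hom_vs_def)

lemma twist_free_hom_vs_superset:
  assumes "finite K" "Poly_Mapping.keys p \<subseteq> K"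
  shows "twist (free_hom_vs S f) p = (\<Sum>x\<in>K. Poly_Mapping.single (f x) (Poly_Mapping.lookup p x))"
  unfolding free_hom_vs_def using assms by (auto intro!: sum.mono_neutral_left simp: in_keys_iff)

lemma twist_free_hom_vs_single [simp]:
  "twist (free_hom_vs S f) (Poly_Mapping.single x c) = Poly_Mapping.single (f x) c"
  by (subst twist_free_hom_vs_superset[of "{x}"]) auto

lemma twist_free_hom_vs_zero [simp]: "twist (free_hom_vs S f) 0 = 0"
  by (simp add: free_hom_vs_def)

lemma twist_free_hom_vs_add [simp]:
  "twist (free_hom_vs S f) (p + q) = twist (free_hom_vs S f) p + twist (free_hom_vs S f) q"
  using keys_add[of p q]
  by (subst (1 2 3) twist_free_hom_vs_superset[of "Poly_Mapping.keys p \<union> Poly_Mapping.keys q"])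
    (auto simp: lookup_add single_add sum.distrib)

lemma twist_free_hom_vs_smult [simp]:
  "twist (free_hom_vs S f) (pm_scale c p) = pm_scale c (twist (free_hom_vs S f) p)"
  using keys_pm_scale[of c p]
  by (subst (1 2) twist_free_hom_vs_superset[of "Poly_Mapping.keys p"])
    (auto simp: pm.scale_sum_right)

lemma hom_lie_algebra_free:
  fixes f :: "'v \<Rightarrow> 'v"
  assumes "f \<in> S \<rightarrow> S"
  shows "hom_lie_algebra (free_hom_vs S f :: ('f::field, 'v \<Rightarrow>\<^sub>0 'f) hom_alg)"
proof -
  have *: "Poly_Mapping.keys (twist (free_hom_vs S f :: ('f, 'v \<Rightarrow>\<^sub>0 'f) hom_alg) p) \<subseteq> S" if "Poly_Mapping.keys p \<subseteq> S" for p
    using that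
    by (induction rule: pm_induct)
      (use assms in \<open>simp_all add: keys_pm_add Pi_iff\<close>)
  have H: "hom_vector_space (free_hom_vs S f :: ('f, 'v \<Rightarrow>\<^sub>0 'f) hom_alg)"
    by (rule hom_vector_spaceI)
      (simp_all add: * keys_pm_add order.trans[OF keys_pm_scale] pm.scale_left_distrib
        pm.scale_right_distrib ac_simps)
  then interpret hom_vector_space "free_hom_vs S f :: ('f, 'v \<Rightarrow>\<^sub>0 'f) hom_alg" .
  show ?thesis
    \<comment> \<open>As all brackets are 0, the one axiom that needs an argument is skew symmetry,
      which becomes \<open>0 = \<ominus> 0\<close> for the negation of the free space.\<close>
    using smult_minus_1[of 0]
    by (intro hom_lie_algebra.intro H hom_lie_algebra_axioms.intro) simp_all
qed

section \<open>Presented Hom-Lie algebras\<close>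

lemma hl_class_eqI: "hl_cong R s t \<Longrightarrow> hl_class S R s = hl_class S R t"
  unfolding hl_class_def by (blast intro: hl_cong.sym hl_cong.trans)

lemma hl_class_self: "gens s \<subseteq> S \<Longrightarrow> s \<in> hl_class S R s"
  by (simp add: hl_class_def hl_cong.refl)

text \<open>As for cosets: a union over all representatives of a class collapses when the value
  respects the congruence.\<close>

lemma UN_hl_class:
  assumes "gens s \<subseteq> S" and "\<And>s'. hl_cong R s s' \<Longrightarrow> F s' = F s"
  shows "(\<Union>s'\<in>hl_class S R s. F s') = F s"
  using assms hl_class_self[OF assms(1), of R] unfolding hl_class_def by blast

lemma presented_carrier: "carrier (presented S R) = hl_class S R ` {t. gens t \<subseteq> S}"
  by (simp add: presented_def)

lemma presented_zero: "\<zero>\<^bsub>presented S R\<^esub> = hl_class S R Zero"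
  by (simp add: presented_def)

lemma presented_add:
  assumes "gens s \<subseteq> S" "gens t \<subseteq> S"
  shows "hl_class S R s \<oplus>\<^bsub>presented S R\<^esub> hl_class S R t = hl_class S R (Add s t)"
proof -
  have "(\<Union>t'\<in>hl_class S R t. hl_class S R (Add s' t')) = hl_class S R (Add s' t)" for s'
    by (intro UN_hl_class[OF assms(2)] hl_class_eqI hl_cong.cong_Add hl_cong.refl) (rule hl_cong.sym)
  moreover have "(\<Union>s'\<in>hl_class S R s. hl_class S R (Add s' t)) = hl_class S R (Add s t)"
    by (intro UN_hl_class[OF assms(1)] hl_class_eqI hl_cong.cong_Add hl_cong.refl) (rule hl_cong.sym)
  ultimately show ?thesis
    by (simp add: presented_def)
qed

lemma presented_bracket:
  assumes "gens s \<subseteq> S" "gens t \<subseteq> S"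
  shows "bracket (presented S R) (hl_class S R s) (hl_class S R t) = hl_class S R (Bracket s t)"
proof -
  have "(\<Union>t'\<in>hl_class S R t. hl_class S R (Bracket s' t')) = hl_class S R (Bracket s' t)" for s'
    by (intro UN_hl_class[OF assms(2)] hl_class_eqI hl_cong.cong_Bracket hl_cong.refl) (rule hl_cong.sym)
  moreover have "(\<Union>s'\<in>hl_class S R s. hl_class S R (Bracket s' t)) = hl_class S R (Bracket s t)"
    by (intro UN_hl_class[OF assms(1)] hl_class_eqI hl_cong.cong_Bracket hl_cong.refl) (rule hl_cong.sym)
  ultimately show ?thesis
    by (simp add: presented_def)
qed

lemma presented_smult:
  assumes "gens s \<subseteq> S"
  shows "c \<odot>\<^bsub>presented S R\<^esub> hl_class S R s = hl_class S R (Smult c s)"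
  unfolding presented_def
  by simp (intro UN_hl_class[OF assms] hl_class_eqI hl_cong.cong_Smult, rule hl_cong.sym)

lemma presented_twist:
  assumes "gens s \<subseteq> S"
  shows "twist (presented S R) (hl_class S R s) = hl_class S R (Twist s)"
  unfolding presented_def
  by simp (intro UN_hl_class[OF assms] hl_class_eqI hl_cong.cong_Twist, rule hl_cong.sym)

lemma gens_simps:
  "gens Zero \<subseteq> S"
  "gens (Smult c s) \<subseteq> S \<longleftrightarrow> gens s \<subseteq> S"
  "gens (Twist s) \<subseteq> S \<longleftrightarrow> gens s \<subseteq> S"
  "\<lbrakk>gens s \<subseteq> S; gens t \<subseteq> S\<rbrakk> \<Longrightarrow> gens (Add s t) \<subseteq> S"
  "\<lbrakk>gens s \<subseteq> S; gens t \<subseteq> S\<rbrakk> \<Longrightarrow> gens (Bracket s t) \<subseteq> S"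
  by simp_all

lemmas presented_simps =
  presented_carrier presented_zero presented_add presented_smult presented_bracket presented_twist

text \<open>Each axiom is, up to commutativity of addition, a rule of \<open>hl_cong\<close>, hence
  an equation between classes. For skew symmetry the negation must first be recognised as the class
  of \<open>Smult (- 1) s\<close>.\<close>

lemma presented_hom_lie_algebra: "hom_lie_algebra (presented S R)"
proof -
  have neg: "hl_class S R (Add (Smult (- 1) s) s) = hl_class S R Zero" for s
    using hl_cong.add_comm hl_cong.add_neg by (rule hl_class_eqI[OF hl_cong.trans])
  note rules = neg hl_cong.add_assoc[THEN hl_class_eqI] hl_cong.add_comm[THEN hl_class_eqI]
    hl_cong.add_zero[THEN hl_class_eqI] hl_cong.smult_add_left[THEN hl_class_eqI]
    hl_cong.smult_add_right[THEN hl_class_eqI] hl_cong.smult_assoc[THEN hl_class_eqI]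
    hl_cong.smult_one[THEN hl_class_eqI] hl_cong.twist_add[THEN hl_class_eqI]
    hl_cong.twist_smult[THEN hl_class_eqI] hl_cong.bracket_add_left[THEN hl_class_eqI]
    hl_cong.bracket_add_right[THEN hl_class_eqI] hl_cong.bracket_smult_left[THEN hl_class_eqI]
    hl_cong.bracket_smult_right[THEN hl_class_eqI] hl_cong.skew[THEN hl_class_eqI]
    hl_cong.jacobi[THEN hl_class_eqI] hl_cong.twist_bracket[THEN hl_class_eqI]
  have mem: "gens s \<subseteq> S \<Longrightarrow> hl_class S R s \<in> hl_class S R ` {t. gens t \<subseteq> S}" for s
    by blast
  have H: "hom_vector_space (presented S R)"
    by (rule hom_vector_spaceI, unfold presented_carrier; (elim imageE CollectE)?;
        simp only: presented_simps gens_simps; (rule rules mem)?; simp)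
  then interpret hom_vector_space "presented S R" .
  have minus: "\<ominus>\<^bsub>presented S R\<^esub> hl_class S R s = hl_class S R (Smult (- 1) s)" if "gens s \<subseteq> S" for s
    using that smult_minus_1[of "hl_class S R s"] by (simp add: presented_simps)
  show ?thesis
    by (rule hom_lie_algebra.intro[OF H], rule hom_lie_algebra_axioms.intro, unfold presented_carrier;
        (elim imageE CollectE)?; simp only: presented_simps gens_simps minus; (rule rules mem)?; simp)
qed

text \<open>
  The value of a functional that kills brackets.  The argument \<open>n\<close> counts the applications of \<open>Twist\<close>
  still to be passed on to the generators, so that no structure map on the target is needed.
\<close>

primrec hl_eval :: "(nat \<Rightarrow> 'g \<Rightarrow> 'f::field) \<Rightarrow> ('f, 'g) hl_term \<Rightarrow> nat \<Rightarrow> 'f"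
  where
    "hl_eval b (Gen g) n = b n g"
  | "hl_eval b Zero n = 0"
  | "hl_eval b (Add s t) n = hl_eval b s n + hl_eval b t n"
  | "hl_eval b (Smult c s) n = c * hl_eval b s n"
  | "hl_eval b (Bracket s t) n = 0"
  | "hl_eval b (Twist s) n = hl_eval b s (Suc n)"

text \<open>Both sides of the Lie rules evaluate to 0 because brackets do, and the remaining rules
  express linearity. The level \<open>n\<close> must vary in the induction, since
  \<open>Twist\<close> raises it by one.\<close>

lemma hl_eval_cong:
  assumes "hl_cong R s t" and "\<And>s t n. R s t \<Longrightarrow> hl_eval b s n = hl_eval b t n"
  shows "hl_eval b s n = hl_eval b t n"
  using assms(1)
proof (induction arbitrary: n rule: hl_cong.induct)
  case (relation s t)
  then show ?case
    by (rule assms(2))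
qed (simp_all add: algebra_simps)

section \<open>The tensor square\<close>

text \<open>Surjectivity serves to write an arbitrary element as \<open>twist L w\<close>, the shape
  in which the two bracket relations of the tensor square need one of their arguments.\<close>

locale regular_hom_lie_algebra = hom_lie_algebra L
  for L :: "('f::field, 'v) hom_alg" (structure) +
  assumes twist_surj: "twist L ` carrier L = carrier L"
begin

section \<open>The defining relations of the tensor square as equations\<close>

abbreviation T where "T \<equiv> tensor_square L"
abbreviation tensor (infixl "\<star>" 75) where "x \<star> y \<equiv> star L x y"

sublocale T: hom_lie_algebra T
  unfolding tensor_square_def by (rule presented_hom_lie_algebra)

lemma tensor_closed [simp]: "\<lbrakk>x \<in> carrier L; y \<in> carrier L\<rbrakk> \<Longrightarrow> x \<star> y \<in> carrier T"
  by (auto simp: star_def tensor_square_def presented_carrier)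

lemmas star_simps = star_def tensor_square_def presented_simps

lemma star_rel_class:
  "star_rel L s t \<Longrightarrow> hl_class S (star_rel L) s = hl_class S (star_rel L) t"
  by (rule hl_class_eqI) (rule hl_cong.relation)

context
  fixes x y z :: 'v
  assumes carr [simp]: "x \<in> carrier L" "y \<in> carrier L" "z \<in> carrier L"
begin

lemma tensor_add_left: "(x \<oplus> y) \<star> z = x \<star> z \<oplus>\<^bsub>T\<^esub> y \<star> z"
  by (simp add: star_simps star_rel_class[OF star_rel.star_add_left])

lemma tensor_add_right: "x \<star> (y \<oplus> z) = x \<star> y \<oplus>\<^bsub>T\<^esub> x \<star> z"
  by (simp add: star_simps star_rel_class[OF star_rel.star_add_right])

lemma tensor_bracket_left_expand:
  "bracket L x y \<star> twist L z =
    twist L x \<star> bracket L y z \<oplus>\<^bsub>T\<^esub> (- 1) \<odot>\<^bsub>T\<^esub> (twist L y \<star> bracket L x z)"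
  by (simp add: star_simps star_rel_class[OF star_rel.bracket_left] twist_closed bracket_closed)

lemma tensor_bracket_right_expand:
  "twist L x \<star> bracket L y z =
    bracket L z x \<star> twist L y \<oplus>\<^bsub>T\<^esub> (- 1) \<odot>\<^bsub>T\<^esub> (bracket L y x \<star> twist L z)"
  by (simp add: star_simps star_rel_class[OF star_rel.bracket_right] twist_closed bracket_closed)

end

lemma tensor_smult_left:
  "\<lbrakk>x \<in> carrier L; y \<in> carrier L\<rbrakk> \<Longrightarrow> (c \<odot> x) \<star> y = c \<odot>\<^bsub>T\<^esub> (x \<star> y)"
  by (simp add: star_simps star_rel_class[OF star_rel.star_smult_left])

lemma tensor_smult_right:
  "\<lbrakk>x \<in> carrier L; y \<in> carrier L\<rbrakk> \<Longrightarrow> x \<star> (c \<odot> y) = c \<odot>\<^bsub>T\<^esub> (x \<star> y)"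
  by (simp add: star_simps star_rel_class[OF star_rel.star_smult_right])

lemma twist_tensor:
  "\<lbrakk>x \<in> carrier L; y \<in> carrier L\<rbrakk> \<Longrightarrow> twist T (x \<star> y) = twist L x \<star> twist L y"
  by (simp add: star_simps star_rel_class[OF star_rel.twist_star])

lemma bracket_tensor:
  "\<lbrakk>x \<in> carrier L; y \<in> carrier L; x' \<in> carrier L; y' \<in> carrier L\<rbrakk> \<Longrightarrow>
    bracket T (x \<star> y) (x' \<star> y') = (- 1) \<odot>\<^bsub>T\<^esub> (bracket L y x \<star> bracket L x' y')"
  by (simp add: star_simps star_rel_class[OF star_rel.bracket_star] bracket_closed)

lemma tensor_square_alternating: "t \<in> carrier T \<Longrightarrow> bracket T t t = \<zero>\<^bsub>T\<^esub>"
  by (auto simp: tensor_square_def presented_simps hl_cong.alternating[THEN hl_class_eqI])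

section \<open>Consequences of the bracket relations\<close>

lemma bracket_skew': "\<lbrakk>x \<in> carrier L; y \<in> carrier L\<rbrakk> \<Longrightarrow> (- 1) \<odot> bracket L x y = bracket L y x"
  using bracket_skew[of y x] by (simp add: smult_minus_1 bracket_closed)

text \<open>A minus sign is absorbed by exchanging the arguments of a bracket, which turns the two
  bracket relations into sums without signs.\<close>

lemma tensor_minus_left:
  "\<lbrakk>x \<in> carrier L; y \<in> carrier L; z \<in> carrier L\<rbrakk> \<Longrightarrow>
    (- 1) \<odot>\<^bsub>T\<^esub> (bracket L x y \<star> z) = bracket L y x \<star> z"
  by (simp add: bracket_closed bracket_skew' flip: tensor_smult_left)

lemma tensor_minus_right:
  "\<lbrakk>x \<in> carrier L; y \<in> carrier L; z \<in> carrier L\<rbrakk> \<Longrightarrow>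
    (- 1) \<odot>\<^bsub>T\<^esub> (z \<star> bracket L x y) = z \<star> bracket L y x"
  by (simp add: bracket_closed bracket_skew' flip: tensor_smult_right)

lemma tensor_bracket_twist_cancel:
  assumes "x \<in> carrier L" "y \<in> carrier L" "z \<in> carrier L"
  shows "twist L x \<star> bracket L y z \<oplus>\<^bsub>T\<^esub> bracket L y z \<star> twist L x = \<zero>\<^bsub>T\<^esub>"
proof -
  define F where "F x y z = twist L x \<star> bracket L y z" for x y z
  define G where "G x y z = bracket L y z \<star> twist L x" for x y z
  have clsd [simp]: "F x y z \<in> carrier T" "G x y z \<in> carrier T"
    if "x \<in> carrier L" "y \<in> carrier L" "z \<in> carrier L" for x y z
    using that by (simp_all add: F_def G_def twist_closed bracket_closed)
  have G: "G x y z = F y z x \<oplus>\<^bsub>T\<^esub> F z x y"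
    if "x \<in> carrier L" "y \<in> carrier L" "z \<in> carrier L" for x y z
    using that by (simp add: F_def G_def tensor_bracket_left_expand tensor_minus_right twist_closed)
  have F: "F x y z = G y z x \<oplus>\<^bsub>T\<^esub> G z x y"
    if "x \<in> carrier L" "y \<in> carrier L" "z \<in> carrier L" for x y z
    using that unfolding F_def G_def
    by (subst tensor_bracket_right_expand) (simp_all add: tensor_minus_left twist_closed)
  \<comment> \<open>Applying \<open>F\<close> and then \<open>G\<close> to both summands yields
    \<open>F x y z\<close> twice and each of its two other cyclic permutations once. Cancelling one
    copy leaves the cyclic sum, without any division by 2.\<close>
  have "F x y z \<oplus>\<^bsub>T\<^esub> (F y z x \<oplus>\<^bsub>T\<^esub> F z x y \<oplus>\<^bsub>T\<^esub> F x y z) = F x y z"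
    using assms F[of x y z] by (simp add: G T.a_ac)
  also have "\<dots> = F x y z \<oplus>\<^bsub>T\<^esub> \<zero>\<^bsub>T\<^esub>"
    using assms by simp
  finally have "F y z x \<oplus>\<^bsub>T\<^esub> F z x y \<oplus>\<^bsub>T\<^esub> F x y z = \<zero>\<^bsub>T\<^esub>"
    using assms by (simp only: T.add.l_cancel T.a_closed T.zero_closed clsd)
  then show ?thesis
    using assms G[of x y z] by (simp add: T.a_ac flip: F_def G_def)
qed

lemma tensor_bracket_cancel:
  assumes "x \<in> carrier L" "y \<in> carrier L" "z \<in> carrier L"
  shows "x \<star> bracket L y z \<oplus>\<^bsub>T\<^esub> bracket L y z \<star> x = \<zero>\<^bsub>T\<^esub>"
proof -
  obtain w where "w \<in> carrier L" "x = twist L w"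
    using assms(1) twist_surj by blast
  then show ?thesis
    using tensor_bracket_twist_cancel[of w y z] assms(2,3) by simp
qed

text \<open>By the product rule \<open>[x, y] \<star> [x, y]\<close> is the bracket of
  \<open>x \<star> y\<close> with itself, which vanishes because the product is alternating.\<close>

lemma tensor_bracket_self:
  assumes "x \<in> carrier L" "y \<in> carrier L"
  shows "bracket L x y \<star> bracket L x y = \<zero>\<^bsub>T\<^esub>"
  using assms bracket_tensor[of x y x y]
  by (simp add: tensor_square_alternating tensor_minus_left bracket_closed)

text \<open>With \<open>y\<close> written as a twist, the first bracket relation produces a
  difference of two equal terms. In characteristic 2 skew symmetry alone does not make
  \<open>bracket L x x\<close> zero.\<close>

lemma self_bracket_tensor:
  assumes "x \<in> carrier L" "y \<in> carrier L"
  shows "bracket L x x \<star> y = \<zero>\<^bsub>T\<^esub>"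
proof -
  obtain z where "z \<in> carrier L" "y = twist L z"
    using assms(2) twist_surj by blast
  then show ?thesis
    using assms(1)
    by (simp add: tensor_bracket_left_expand T.smult_minus_1 T.r_neg twist_closed bracket_closed)
qed

section \<open>Squares modulo the derived ideal\<close>

lemma derived_gens_subset:
  "{bracket L x y | x y. x \<in> carrier L \<and> y \<in> carrier L} \<subseteq> carrier L"
  using bracket_closed by auto

lemma derived_submodule: "submodule (derived_ideal L) scalars L"
  unfolding derived_ideal_def by (rule lin_span_submodule[OF derived_gens_subset])

lemma derived_subset: "derived_ideal L \<subseteq> carrier L"
  by (rule submoduleE(1)[OF derived_submodule])

lemma bracket_in_derived: "\<lbrakk>x \<in> carrier L; y \<in> carrier L\<rbrakk> \<Longrightarrow> bracket L x y \<in> derived_ideal L"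
  unfolding derived_ideal_def by (rule subsetD[OF lin_span_superset]) blast

sublocale D: hom_lie_ideal "derived_ideal L" L
proof (rule hom_lie_ideal.intro[OF hom_lie_algebra_axioms hom_lie_ideal_axioms.intro])
  show "twist L x \<in> derived_ideal L" if "x \<in> derived_ideal L" for x
  proof (rule lin_span_stable[OF derived_gens_subset derived_submodule _ _ _ _ _ that[unfolded derived_ideal_def]])
    show "twist L x \<in> derived_ideal L"
      if "x \<in> {bracket L x y | x y. x \<in> carrier L \<and> y \<in> carrier L}" for x
      using that by (auto simp: twist_bracket twist_closed bracket_in_derived)
  qed (simp_all add: twist_closed twist_add twist_smult)
  show "bracket L x y \<in> derived_ideal L" if "x \<in> carrier L" "y \<in> derived_ideal L" for x y
    using that(1) subsetD[OF derived_subset that(2)] by (rule bracket_in_derived)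
qed (rule derived_submodule)

text \<open>The two identities are proved together: the elements with \<open>d \<star> d\<close>
  zero alone need not be closed under addition, but the mixed terms of
  \<open>(d \<oplus> e) \<star> (d \<oplus> e)\<close> cancel by the first identity.\<close>

lemma tensor_derived:
  assumes "d \<in> derived_ideal L"
  shows "x \<in> carrier L \<Longrightarrow> x \<star> d \<oplus>\<^bsub>T\<^esub> d \<star> x = \<zero>\<^bsub>T\<^esub>" and "d \<star> d = \<zero>\<^bsub>T\<^esub>"
proof -
  let ?H = "{d \<in> carrier L. (\<forall>x\<in>carrier L. x \<star> d \<oplus>\<^bsub>T\<^esub> d \<star> x = \<zero>\<^bsub>T\<^esub>) \<and> d \<star> d = \<zero>\<^bsub>T\<^esub>}"
  have zero: "x \<star> \<zero> = \<zero>\<^bsub>T\<^esub>" "\<zero> \<star> x = \<zero>\<^bsub>T\<^esub>" if "x \<in> carrier L" for x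
    using that tensor_smult_right[of x x 0] tensor_smult_left[of x x 0] by simp_all
  have "submodule ?H scalars L"
  proof (rule submoduleI')
    show "d \<oplus> e \<in> ?H" if d: "d \<in> ?H" and e: "e \<in> ?H" for d e
    proof -
      have "x \<star> (d \<oplus> e) \<oplus>\<^bsub>T\<^esub> (d \<oplus> e) \<star> x =
          (x \<star> d \<oplus>\<^bsub>T\<^esub> d \<star> x) \<oplus>\<^bsub>T\<^esub> (x \<star> e \<oplus>\<^bsub>T\<^esub> e \<star> x)" if "x \<in> carrier L" for x
        using that d e by (simp add: tensor_add_left tensor_add_right T.a_ac)
      moreover have "(d \<oplus> e) \<star> (d \<oplus> e) = d \<star> d \<oplus>\<^bsub>T\<^esub> (d \<star> e \<oplus>\<^bsub>T\<^esub> e \<star> d) \<oplus>\<^bsub>T\<^esub> e \<star> e"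
        using d e by (simp add: tensor_add_left tensor_add_right T.a_ac)
      ultimately show ?thesis
        using d e by simp
    qed
    show "c \<odot> d \<in> ?H" if d: "d \<in> ?H" for c d
    proof -
      have "x \<star> (c \<odot> d) \<oplus>\<^bsub>T\<^esub> (c \<odot> d) \<star> x = c \<odot>\<^bsub>T\<^esub> (x \<star> d \<oplus>\<^bsub>T\<^esub> d \<star> x)" if "x \<in> carrier L" for x
        using that d by (simp add: tensor_smult_left tensor_smult_right flip: T.smult_add_right)
      then show ?thesis
        using d by (simp add: tensor_smult_left tensor_smult_right)
    qed
  qed (use zero in auto)
  moreover have "bracket L y z \<in> ?H" if "y \<in> carrier L" "z \<in> carrier L" for y z
    using that by (simp add: bracket_closed tensor_bracket_cancel tensor_bracket_self)
  then have "{bracket L x y | x y. x \<in> carrier L \<and> y \<in> carrier L} \<subseteq> ?H"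
    by blast
  ultimately have "derived_ideal L \<subseteq> ?H"
    unfolding derived_ideal_def by (rule lin_span_minimal[rotated])
  then show "x \<in> carrier L \<Longrightarrow> x \<star> d \<oplus>\<^bsub>T\<^esub> d \<star> x = \<zero>\<^bsub>T\<^esub>" and "d \<star> d = \<zero>\<^bsub>T\<^esub>"
    using assms by auto
qed

lemma tensor_self_add_derived:
  assumes "d \<in> derived_ideal L" "x \<in> carrier L"
  shows "(d \<oplus> x) \<star> (d \<oplus> x) = x \<star> x"
proof -
  have d: "d \<in> carrier L"
    using assms(1) derived_subset by blast
  have "(d \<oplus> x) \<star> (d \<oplus> x) = d \<star> d \<oplus>\<^bsub>T\<^esub> (x \<star> d \<oplus>\<^bsub>T\<^esub> d \<star> x) \<oplus>\<^bsub>T\<^esub> x \<star> x"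
    using d assms by (simp add: tensor_add_left tensor_add_right T.a_ac)
  then show ?thesis
    using assms d by (simp add: tensor_derived)
qed

section \<open>Generators of the tensor square and centrality of squares\<close>

lemma bracket_zero: "t \<in> carrier T \<Longrightarrow> bracket T t \<zero>\<^bsub>T\<^esub> = \<zero>\<^bsub>T\<^esub>"
    "t \<in> carrier T \<Longrightarrow> bracket T \<zero>\<^bsub>T\<^esub> t = \<zero>\<^bsub>T\<^esub>"
  using T.bracket_smult_right[of t "\<zero>\<^bsub>T\<^esub>" 0] T.bracket_smult_left[of "\<zero>\<^bsub>T\<^esub>" t 0]
  by (simp_all add: T.bracket_closed)

lemma bracket_left_span:
  assumes "S \<subseteq> carrier T" "submodule H scalars T" "t \<in> carrier T"
    and "\<And>s. s \<in> S \<Longrightarrow> bracket T s t \<in> H" and "s \<in> lin_span T S"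
  shows "bracket T s t \<in> H"
  by (rule T.lin_span_stable[OF assms(1,2) _ _ _ _ assms(4,5)])
    (simp_all add: assms(3) bracket_zero T.bracket_closed T.bracket_add_left T.bracket_smult_left)

lemma bracket_right_span:
  assumes "S \<subseteq> carrier T" "submodule H scalars T" "t \<in> carrier T"
    and "\<And>s. s \<in> S \<Longrightarrow> bracket T t s \<in> H" and "s \<in> lin_span T S"
  shows "bracket T t s \<in> H"
  by (rule T.lin_span_stable[OF assms(1,2) _ _ _ _ assms(4,5)])
    (simp_all add: assms(3) bracket_zero T.bracket_closed T.bracket_add_right T.bracket_smult_right)

lemma twist_span:
  assumes "S \<subseteq> carrier T" "submodule H scalars T"
    and "\<And>s. s \<in> S \<Longrightarrow> twist T s \<in> H" and "s \<in> lin_span T S"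
  shows "twist T s \<in> H"
  by (rule T.lin_span_stable[OF assms(1,2) _ _ _ _ assms(3,4)])
    (simp_all add: T.twist_closed T.twist_add T.twist_smult)

lemma tensor_gens_subset: "{x \<star> y | x y. x \<in> carrier L \<and> y \<in> carrier L} \<subseteq> carrier T"
  by auto

text \<open>The bracket of two generators is a multiple of a generator and the twist of a generator
  is a generator. So their linear span is closed under every term constructor, and induction on
  terms applies.\<close>

lemma tensors_span: "carrier T = lin_span T {x \<star> y | x y. x \<in> carrier L \<and> y \<in> carrier L}"
proof
  let ?G = "{x \<star> y | x y. x \<in> carrier L \<and> y \<in> carrier L}"
  let ?c = "hl_class (carrier L \<times> carrier L) (star_rel L)"
  have sub: "submodule (lin_span T ?G) scalars T"
    by (rule T.lin_span_submodule[OF tensor_gens_subset])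
  note subE = T.submodule_zero[OF sub] T.submoduleE(4,5)[OF sub]
  have carr: "lin_span T ?G \<subseteq> carrier T"
    using T.submoduleE(1)[OF sub] .
  have gen: "x \<star> y \<in> lin_span T ?G" if "x \<in> carrier L" "y \<in> carrier L" for x y
    by (rule subsetD[OF T.lin_span_superset]) (use that in blast)
  have tw: "twist T t \<in> lin_span T ?G" if "t \<in> lin_span T ?G" for t
  proof (rule twist_span[OF tensor_gens_subset sub _ that])
    show "twist T s \<in> lin_span T ?G" if "s \<in> ?G" for s
      using that by (auto simp: twist_tensor twist_closed gen)
  qed
  have br1: "bracket T (x \<star> y) t \<in> lin_span T ?G"
    if "x \<in> carrier L" "y \<in> carrier L" "t \<in> lin_span T ?G" for x y t
  proof (rule bracket_right_span[OF tensor_gens_subset sub tensor_closed[OF that(1,2)] _ that(3)])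
    show "bracket T (x \<star> y) s \<in> lin_span T ?G" if "s \<in> ?G" for s
      using that \<open>x \<in> carrier L\<close> \<open>y \<in> carrier L\<close>
      by (auto simp: bracket_tensor gen bracket_closed subE(2))
  qed
  have br: "bracket T s t \<in> lin_span T ?G" if "t \<in> lin_span T ?G" "s \<in> lin_span T ?G" for s t
  proof (rule bracket_left_span[OF tensor_gens_subset sub subsetD[OF carr that(1)] _ that(2)])
    show "bracket T s t \<in> lin_span T ?G" if "s \<in> ?G" for s
      using that br1 \<open>t \<in> lin_span T ?G\<close> by auto
  qed
  have "?c s \<in> lin_span T ?G" if "gens s \<subseteq> carrier L \<times> carrier L" for s
    using that
  proof (induction s)
    case (Gen g)
    then show ?case
      using gen by (cases g) (simp add: star_def[symmetric])
  next
    case Zero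
    then show ?case
      using subE(1) by (simp add: tensor_square_def presented_simps)
  next
    case (Add s t)
    then show ?case
      using subE(3)[of "?c s" "?c t"] by (simp add: tensor_square_def presented_simps)
  next
    case (Smult c s)
    then show ?case
      using subE(2)[of c "?c s"] by (simp add: tensor_square_def presented_simps)
  next
    case (Bracket s t)
    then show ?case
      using br[of "?c t" "?c s"] by (simp add: tensor_square_def presented_simps)
  next
    case (Twist s)
    then show ?case
      using tw[of "?c s"] by (simp add: tensor_square_def presented_simps)
  qed
  then show "carrier T \<subseteq> lin_span T ?G"
    by (auto simp: tensor_square_def presented_carrier)
  show "lin_span T ?G \<subseteq> carrier T"
    by (rule carr)
qed

lemma zero_submodule: "submodule {\<zero>\<^bsub>T\<^esub>} scalars T"
  by (rule T.submoduleI') simp_all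

text \<open>The bracket with a generator has the left factor \<open>bracket L x x\<close>, so
  \<open>self_bracket_tensor\<close> kills it; the generators span.\<close>

lemma tensor_self_central:
  assumes "x \<in> carrier L" "t \<in> carrier T"
  shows "bracket T (x \<star> x) t = \<zero>\<^bsub>T\<^esub>"
proof -
  have "bracket T (x \<star> x) t \<in> {\<zero>\<^bsub>T\<^esub>}"
  proof (rule bracket_right_span[OF tensor_gens_subset zero_submodule])
    show "bracket T (x \<star> x) s \<in> {\<zero>\<^bsub>T\<^esub>}"
      if "s \<in> {x \<star> y | x y. x \<in> carrier L \<and> y \<in> carrier L}" for s
      using that assms(1) by (auto simp: bracket_tensor self_bracket_tensor bracket_closed)
  qed (use assms tensors_span tensor_closed[OF assms(1) assms(1)] in blast)+
  then show ?thesis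
    by simp
qed

section \<open>The ideal spanned by the squares\<close>

lemma square_gens_subset: "{x \<star> x | x. x \<in> carrier L} \<subseteq> carrier T"
  by auto

lemma square_submodule: "submodule (square_ideal L) scalars T"
  unfolding square_ideal_def by (rule T.lin_span_submodule[OF square_gens_subset])

lemma tensor_self_in_square_ideal: "x \<in> carrier L \<Longrightarrow> x \<star> x \<in> square_ideal L"
  unfolding square_ideal_def by (rule subsetD[OF T.lin_span_superset]) blast

lemma square_ideal_central:
  assumes "s \<in> square_ideal L" "t \<in> carrier T"
  shows "bracket T s t = \<zero>\<^bsub>T\<^esub>"
proof -
  have "bracket T s t \<in> {\<zero>\<^bsub>T\<^esub>}"
  proof (rule bracket_left_span[OF square_gens_subset zero_submodule assms(2) _ assms(1)[unfolded square_ideal_def]])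
    show "bracket T s t \<in> {\<zero>\<^bsub>T\<^esub>}" if "s \<in> {x \<star> x | x. x \<in> carrier L}" for s
      using that tensor_self_central[OF _ assms(2)] by auto
  qed
  then show ?thesis
    by simp
qed

sublocale Sq: hom_lie_ideal "square_ideal L" T
proof (rule hom_lie_ideal.intro[OF T.hom_lie_algebra_axioms hom_lie_ideal_axioms.intro])
  show "twist T t \<in> square_ideal L" if "t \<in> square_ideal L" for t
  proof (rule twist_span[OF square_gens_subset square_submodule _ that[unfolded square_ideal_def]])
    show "twist T s \<in> square_ideal L" if "s \<in> {x \<star> x | x. x \<in> carrier L}" for s
      using that by (auto simp: twist_tensor twist_closed tensor_self_in_square_ideal)
  qed
  show "bracket T t s \<in> square_ideal L" if "t \<in> carrier T" "s \<in> square_ideal L" for t s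
  proof -
    have "s \<in> carrier T"
      using that(2) T.submoduleE(1)[OF square_submodule] by blast
    then show ?thesis
      using that T.bracket_skew[of t s] T.submodule_zero[OF square_submodule]
      by (simp add: square_ideal_central T.smult_minus_1[symmetric])
  qed
qed (rule square_submodule)

end

section \<open>Quadratic forms\<close>

text \<open>
  \<open>Q\<close> is a quadratic form on the quotient by \<open>K\<close>, and the assumption says that \<open>\<Sum> w\<^sub>j v\<^sub>j \<otimes> v\<^sub>j\<close> vanishes
  in the tensor square of that quotient.
\<close>

lemma (in vector_space) quadratic_sum_eq_0:
  fixes Q :: "'b \<Rightarrow> 'a" and B :: "'b \<Rightarrow> 'b \<Rightarrow> 'a"
  assumes "subspace K"
    and Q_scale: "\<And>c x. Q (c *s x) = c^2 * Q x"
    and Q_add: "\<And>x y. Q (x + y) = Q x + Q y + B x y"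
    and B_scale_left: "\<And>c x y. B (c *s x) y = c * B x y"
    and B_scale_right: "\<And>c x y. B x (c *s y) = c * B x y"
    and B_add_right: "\<And>x y z. B x (y + z) = B x y + B x z"
    and Q_K: "\<And>k. k \<in> K \<Longrightarrow> Q k = 0"
    and B_K: "\<And>k x. k \<in> K \<Longrightarrow> B k x = 0" "\<And>k x. k \<in> K \<Longrightarrow> B x k = 0"
    and "finite J"
    and functionals: "\<And>f g. \<lbrakk>Vector_Spaces.linear scale (*) f; Vector_Spaces.linear scale (*) g;
        \<And>k. k \<in> K \<Longrightarrow> f k = 0; \<And>k. k \<in> K \<Longrightarrow> g k = 0\<rbrakk> \<Longrightarrow>
      (\<Sum>j\<in>J. w j * (f (v j) * g (v j))) = 0"
  shows "(\<Sum>j\<in>J. w j * Q (v j)) = 0"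
proof -
  \<comment> \<open>A basis of \<open>K\<close> is extended to a basis \<open>C\<close> of the whole
    space. The coordinates at elements of \<open>C\<close> outside \<open>B0\<close> are then
    functionals that vanish on \<open>K\<close>.\<close>
  obtain B0 where B0: "B0 \<subseteq> K" "independent B0" "K \<subseteq> span B0"
    by (rule basis_exists[of K])
  define C where "C = extend_basis B0"
  have C: "B0 \<subseteq> C" "independent C" "span C = UNIV"
    unfolding C_def
    by (rule extend_basis_superset[OF B0(2)] independent_extend_basis[OF B0(2)] span_extend_basis[OF B0(2)])+
  define r where "r j = representation C (v j)" for j
  have coord_K: "representation C k b = 0" if "b \<notin> B0" "k \<in> K" for b k
  proof -
    have "representation C k = representation B0 k"
      using C(2) subsetD[OF B0(3) that(2)] C(1) by (rule representation_extend)
    then show ?thesis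
      using representation_ne_zero[of B0 k b] that(1) by metis
  qed
  have rr: "(\<Sum>j\<in>J. w j * (r j b * r j c)) = 0" if "b \<notin> B0" "c \<notin> B0" for b c
    unfolding r_def
    by (rule functionals) (use C that in \<open>simp_all add: linear_representation coord_K\<close>)
  \<comment> \<open>Either \<open>b\<close> lies in \<open>K\<close> and \<open>Q b\<close> is 0, or
    the coordinate at \<open>b\<close> is an admissible functional and the sum is 0. The same
    dichotomy for \<open>b\<close> and \<open>c\<close> gives \<open>B_rr\<close>.\<close>
  have Q_rr: "Q b * (\<Sum>j\<in>J. w j * (r j b * r j b)) = 0" for b
    using rr[of b b] Q_K[of b] subsetD[OF B0(1), of b] by (cases "b \<in> B0") simp_all
  have B_rr: "B b c * (\<Sum>j\<in>J. w j * (r j b * r j c)) = 0" for b c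
    using rr[of b c] B_K(1)[of b c] B_K(2)[of c b] subsetD[OF B0(1)]
    by (cases "b \<in> B0"; cases "c \<in> B0") simp_all
  have B_sum: "B x (\<Sum>c\<in>S. a c *s c) = (\<Sum>c\<in>S. a c * B x c)" for x S and a :: "'b \<Rightarrow> 'a"
    using B_scale_right[of x 0 0]
    by (induction S rule: infinite_finite_induct) (simp_all add: B_add_right B_scale_right)
  have Q_zero: "Q 0 = 0"
    using Q_scale[of 0 0] by simp
  \<comment> \<open>Adding one basis vector at a time expands the quadratic form: each mixed term
    \<open>B s c\<close> enters once, when \<open>s\<close> is added, so no ordering of the basis
    has to be fixed.\<close>
  have main: "(\<Sum>j\<in>J. w j * Q (\<Sum>b\<in>S. r j b *s b)) = 0" if "finite S" for S
    using that
  proof (induction S rule: finite_induct)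
    case empty
    then show ?case
      by (simp add: Q_zero)
  next
    case (insert s S)
    have "Q (\<Sum>b\<in>insert s S. r j b *s b) = Q s * (r j s * r j s) + Q (\<Sum>b\<in>S. r j b *s b)
        + (\<Sum>c\<in>S. B s c * (r j s * r j c))" for j
      using insert.hyps
      by (simp add: Q_add Q_scale B_scale_left B_sum power2_eq_square sum_distrib_left ac_simps)
    then have "(\<Sum>j\<in>J. w j * Q (\<Sum>b\<in>insert s S. r j b *s b)) =
        (\<Sum>j\<in>J. Q s * (w j * (r j s * r j s)) + w j * Q (\<Sum>b\<in>S. r j b *s b)
          + (\<Sum>c\<in>S. B s c * (w j * (r j s * r j c))))"
      by (simp add: distrib_left sum_distrib_left mult.left_commute)
    also have "\<dots> = Q s * (\<Sum>j\<in>J. w j * (r j s * r j s)) + (\<Sum>j\<in>J. w j * Q (\<Sum>b\<in>S. r j b *s b))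
        + (\<Sum>c\<in>S. B s c * (\<Sum>j\<in>J. w j * (r j s * r j c)))"
      by (simp only: sum.distrib sum_distrib_left sum.swap[of _ S J])
    also have "\<dots> = 0"
      by (simp only: insert.IH Q_rr B_rr sum.neutral_const add_0)
    finally show ?case .
  qed
  \<comment> \<open>Finitely many basis vectors suffice to expand all the \<open>v j\<close> at
    once.\<close>
  define S where "S = (\<Union>j\<in>J. {b. r j b \<noteq> 0})"
  have "finite S"
    using \<open>finite J\<close> by (simp add: S_def r_def finite_representation)
  have "(\<Sum>b\<in>S. r j b *s b) = v j" if "j \<in> J" for j
  proof -
    have "(\<Sum>b\<in>S. r j b *s b) = (\<Sum>b | r j b \<noteq> 0. r j b *s b)"
      using that \<open>finite S\<close> by (intro sum.mono_neutral_right) (use that in \<open>auto simp: S_def\<close>)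
    also have "\<dots> = v j"
      unfolding r_def using C by (simp add: sum_nonzero_representation_eq)
    finally show ?thesis .
  qed
  then show ?thesis
    using main[OF \<open>finite S\<close>] by simp
qed

text \<open>A basis of \<open>K\<close> stays independent when \<open>x\<close> is added; the
  functional is the coordinate at \<open>x\<close> in a basis extending both.\<close>

lemma (in vector_space) separating_functional:
  assumes "subspace K" "x \<notin> K"
  shows "\<exists>f. Vector_Spaces.linear scale (*) f \<and> (\<forall>k\<in>K. f k = 0) \<and> f x = 1"
proof -
  obtain B0 where B0: "B0 \<subseteq> K" "independent B0" "K \<subseteq> span B0"
    by (rule basis_exists[of K])
  define C where "C = extend_basis (insert x B0)"
  have "x \<notin> span B0"
    using assms(2) subsetD[OF span_minimal[OF B0(1) assms(1)]] by blast
  then have ind: "independent (insert x B0)"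
    using B0(2) by (simp add: independent_insertI)
  have C: "insert x B0 \<subseteq> C" "independent C" "span C = UNIV"
    unfolding C_def
    by (rule extend_basis_superset[OF ind] independent_extend_basis[OF ind] span_extend_basis[OF ind])+
  show ?thesis
  proof (intro exI conjI ballI)
    show "Vector_Spaces.linear scale (*) (\<lambda>y. representation C y x)"
      using C by (intro linear_representation) simp_all
    show "representation C x x = 1"
      using C by (simp add: representation_basis)
    show "representation C k x = 0" if "k \<in> K" for k
    proof -
      have "representation C k = representation B0 k"
        using C(2) subsetD[OF B0(3) that] by (rule representation_extend) (use C(1) in simp)
      then show ?thesis
        using representation_ne_zero[of B0 k x] \<open>x \<notin> span B0\<close> span_base[of x B0] by metis
    qed
  qed
qed

section \<open>The quadratic map into the tensor square\<close>

context regular_hom_lie_algebra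
begin

section \<open>The square map on the abelianization\<close>

abbreviation A where "A \<equiv> abelianization L"
abbreviation cls where "cls \<equiv> ab_class L"

sublocale A: hom_lie_algebra A
  unfolding abelianization_def by (rule D.hom_quot_hom_lie_algebra)

lemma A_carrier: "carrier A = cls ` carrier L"
  by (simp add: abelianization_def ab_class_def D.hom_quot_carrier)

lemma cls_closed [simp]: "x \<in> carrier L \<Longrightarrow> cls x \<in> carrier A"
  by (simp add: A_carrier)

lemma cls_simps:
  "\<lbrakk>x \<in> carrier L; y \<in> carrier L\<rbrakk> \<Longrightarrow> cls x \<oplus>\<^bsub>A\<^esub> cls y = cls (x \<oplus> y)"
  "x \<in> carrier L \<Longrightarrow> c \<odot>\<^bsub>A\<^esub> cls x = cls (c \<odot> x)"
  "x \<in> carrier L \<Longrightarrow> twist A (cls x) = cls (twist L x)"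
  by (simp_all add: abelianization_def ab_class_def D.hom_quot_add D.hom_quot_smult D.hom_quot_twist)

lemma cls_derived: "d \<in> derived_ideal L \<Longrightarrow> cls d = \<zero>\<^bsub>A\<^esub>"
  by (simp add: ab_class_def abelianization_def hom_quot_def D.a_rcos_const)

text \<open>An arbitrary lift of a class. It need not be linear, because by \<open>sq_cls\<close>
  the square of the lift does not depend on the choice.\<close>

definition rep :: "'v set \<Rightarrow> 'v"
  where "rep a = (SOME x. x \<in> carrier L \<and> cls x = a)"

lemma rep:
  assumes "a \<in> carrier A"
  shows "rep a \<in> carrier L" "cls (rep a) = a"
proof -
  have "\<exists>x. x \<in> carrier L \<and> cls x = a"
    using assms by (auto simp: A_carrier)
  then show "rep a \<in> carrier L" "cls (rep a) = a"
    unfolding rep_def by (rule someI2_ex; simp)+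
qed

definition sq where "sq a = rep a \<star> rep a"

lemma sq_closed: "a \<in> carrier A \<Longrightarrow> sq a \<in> carrier T"
  by (simp add: sq_def rep)

lemma sq_cls:
  assumes "x \<in> carrier L"
  shows "sq (cls x) = x \<star> x"
proof -
  have "rep (cls x) \<in> derived_ideal L +> rep (cls x)"
    using assms by (intro D.a_rcos_self rep cls_closed)
  then have "rep (cls x) \<in> derived_ideal L +> x"
    using rep(2)[OF cls_closed[OF assms]] by (simp add: ab_class_def)
  then obtain d where "d \<in> derived_ideal L" "rep (cls x) = d \<oplus> x"
    by (auto simp: a_r_coset_def')
  then show ?thesis
    using assms by (simp add: sq_def tensor_self_add_derived)
qed

lemma twist_sq: "a \<in> carrier A \<Longrightarrow> sq (twist A a) = twist T (sq a)"
  by (auto simp: A_carrier cls_simps sq_cls twist_tensor twist_closed)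

section \<open>The linear extension of the square map to the free vector space\<close>

abbreviation F where "F \<equiv> free_hom_vs (carrier A) (twist A) :: ('f, 'v set \<Rightarrow>\<^sub>0 'f) hom_alg"

sublocale F: hom_lie_algebra F
  by (rule hom_lie_algebra_free) (simp add: A.twist_closed)

definition Psi where "Psi = lin_ext T sq"

lemma sq_Pi: "sq \<in> carrier A \<rightarrow> carrier T"
  by (simp add: sq_closed)

lemmas Psi_simps =
  T.lin_ext_0[OF sq_Pi, folded Psi_def] T.lin_ext_add[OF sq_Pi, folded Psi_def]
  T.lin_ext_smult[OF sq_Pi, folded Psi_def] T.lin_ext_single[OF sq_Pi, folded Psi_def]

lemma Psi_closed: "Poly_Mapping.keys p \<subseteq> carrier A \<Longrightarrow> Psi p \<in> carrier T"
  unfolding Psi_def by (rule T.lin_ext_closed[OF sq_Pi])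

lemma Psi_square_ideal:
  assumes "Poly_Mapping.keys p \<subseteq> carrier A"
  shows "Psi p \<in> square_ideal L"
  unfolding Psi_def
proof (rule T.lin_ext_in_submodule[OF sq_Pi assms square_submodule])
  show "sq ` carrier A \<subseteq> square_ideal L"
    by (auto simp: sq_def rep tensor_self_in_square_ideal)
qed

lemma Psi_twist:
  assumes "Poly_Mapping.keys p \<subseteq> carrier A"
  shows "Psi (twist F p) = twist T (Psi p)"
  using assms
proof (induction rule: pm_induct)
  case (single a c)
  then show ?case
    by (simp add: Psi_simps A.twist_closed twist_sq T.twist_smult sq_closed)
next
  case (add p q)
  then have "Poly_Mapping.keys (twist F p) \<subseteq> carrier A" "Poly_Mapping.keys (twist F q) \<subseteq> carrier A"
    using F.twist_closed[of p] F.twist_closed[of q] by simp_all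
  then show ?case
    using add by (simp add: Psi_simps T.twist_add Psi_closed)
qed (simp add: Psi_simps)

text \<open>The product of \<open>F\<close> is zero, so compatibility with products says that
  brackets of images vanish, which is centrality of \<open>square_ideal L\<close>.\<close>

lemma Psi_hom: "Psi \<in> hom_lie_hom F T"
  unfolding hom_lie_hom_def
  by (simp add: Psi_closed Psi_simps Psi_twist square_ideal_central Psi_square_ideal)

lemma Psi_image: "Psi ` carrier F = square_ideal L"
proof
  show "Psi ` carrier F \<subseteq> square_ideal L"
    by (auto simp: Psi_square_ideal)
  have "submodule (Psi ` carrier F) scalars T"
  proof (rule T.submoduleI')
    show "Psi ` carrier F \<subseteq> carrier T"
      by (auto simp: Psi_closed)
    show "\<zero>\<^bsub>T\<^esub> \<in> Psi ` carrier F"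
      by (rule image_eqI[of _ _ 0]) (simp_all add: Psi_simps)
    show "x \<oplus>\<^bsub>T\<^esub> y \<in> Psi ` carrier F" if x: "x \<in> Psi ` carrier F" and y: "y \<in> Psi ` carrier F" for x y
    proof -
      obtain p q where "x = Psi p" "Poly_Mapping.keys p \<subseteq> carrier A" "y = Psi q" "Poly_Mapping.keys q \<subseteq> carrier A"
        using x y by auto
      then show ?thesis
        by (intro image_eqI[of _ _ "p + q"]) (simp_all add: Psi_simps keys_pm_add)
    qed
    show "c \<odot>\<^bsub>T\<^esub> x \<in> Psi ` carrier F" if x: "x \<in> Psi ` carrier F" for c x
    proof -
      obtain p where "x = Psi p" "Poly_Mapping.keys p \<subseteq> carrier A"
        using x by auto
      then show ?thesis
        by (intro image_eqI[of _ _ "pm_scale c p"]) (simp_all add: Psi_simps order.trans[OF keys_pm_scale])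
    qed
  qed
  moreover have "x \<star> x \<in> Psi ` carrier F" if "x \<in> carrier L" for x
    by (rule image_eqI[of _ _ "Poly_Mapping.single (cls x) 1"]) (use that in \<open>simp_all add: Psi_simps sq_cls\<close>)
  then have "{x \<star> x | x. x \<in> carrier L} \<subseteq> Psi ` carrier F"
    by blast
  ultimately show "square_ideal L \<subseteq> Psi ` carrier F"
    unfolding square_ideal_def by (intro T.lin_span_minimal)
qed

text \<open>Relators are left-hand side minus right-hand side, so their vanishing under
  \<open>Psi\<close> reduces to an equality of two values.\<close>

lemma Psi_diff_eq_0:
  assumes "Poly_Mapping.keys p \<subseteq> carrier A" "Poly_Mapping.keys q \<subseteq> carrier A" "Psi p = Psi q"
  shows "Poly_Mapping.keys (p - q) \<subseteq> carrier A \<and> Psi (p - q) = \<zero>\<^bsub>T\<^esub>"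
proof -
  have eq: "p - q = p + pm_scale (- 1) q"
    by (rule poly_mapping_eqI) (simp add: lookup_add lookup_minus)
  have q: "Poly_Mapping.keys (pm_scale (- 1) q) \<subseteq> carrier A"
    by (rule order.trans[OF keys_pm_scale assms(2)])
  have "Psi (p + pm_scale (- 1) q) = \<zero>\<^bsub>T\<^esub>"
    unfolding Psi_simps(2)[OF assms(1) q] Psi_simps(3)[OF assms(2)] assms(3)
      T.smult_minus_1[OF Psi_closed[OF assms(2)]]
    by (rule T.r_neg[OF Psi_closed[OF assms(2)]])
  then show ?thesis
    unfolding eq using keys_pm_add[OF assms(1) q] by blast
qed

text \<open>After lifting the classes to \<open>L\<close>, both sides of each relation are values of
  the diagonal of the bilinear map \<open>\<star>\<close>, and expanding them gives the same
  terms.\<close>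

lemma Psi_relators:
  assumes "p \<in> gamma_relators A"
  shows "Poly_Mapping.keys p \<subseteq> carrier A \<and> Psi p = \<zero>\<^bsub>T\<^esub>"
proof -
  note simps = Psi_simps keys_pm_add cls_simps sq_cls tensor_add_left tensor_add_right
    tensor_smult_left tensor_smult_right T.smult_add_right T.smult_smult T.a_ac power2_eq_square
  consider
    (1) c a where "a \<in> carrier A"
      "p = Poly_Mapping.single a (c^2) - Poly_Mapping.single (c \<odot>\<^bsub>A\<^esub> a) 1"
  | (2) c a b where "a \<in> carrier A" "b \<in> carrier A"
      "p = (Poly_Mapping.single (c \<odot>\<^bsub>A\<^esub> a \<oplus>\<^bsub>A\<^esub> b) 1 + Poly_Mapping.single a c + Poly_Mapping.single b c)
        - (Poly_Mapping.single (a \<oplus>\<^bsub>A\<^esub> b) c + Poly_Mapping.single (c \<odot>\<^bsub>A\<^esub> a) 1 + Poly_Mapping.single b 1)"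
  | (3) a b c where "a \<in> carrier A" "b \<in> carrier A" "c \<in> carrier A"
      "p = (Poly_Mapping.single (a \<oplus>\<^bsub>A\<^esub> b \<oplus>\<^bsub>A\<^esub> c) 1 + Poly_Mapping.single a 1 + Poly_Mapping.single b 1
          + Poly_Mapping.single c 1)
        - (Poly_Mapping.single (a \<oplus>\<^bsub>A\<^esub> b) 1 + Poly_Mapping.single (a \<oplus>\<^bsub>A\<^esub> c) 1
          + Poly_Mapping.single (b \<oplus>\<^bsub>A\<^esub> c) 1)"
    using assms unfolding gamma_relators_def by blast
  then show ?thesis
  proof cases
    case 1
    then obtain x where "x \<in> carrier L" "a = cls x"
      by (auto simp: A_carrier)
    then show ?thesis
      unfolding 1(2) by (intro Psi_diff_eq_0) (simp_all add: simps)
  next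
    case 2
    then obtain x y where "x \<in> carrier L" "a = cls x" "y \<in> carrier L" "b = cls y"
      by (auto simp: A_carrier)
    then show ?thesis
      unfolding 2(3) by (intro Psi_diff_eq_0) (simp_all add: simps)
  next
    case 3
    then obtain x y z where "x \<in> carrier L" "a = cls x" "y \<in> carrier L" "b = cls y" "z \<in> carrier L" "c = cls z"
      by (auto simp: A_carrier)
    then show ?thesis
      unfolding 3(4) by (intro Psi_diff_eq_0) (simp_all add: simps)
  qed
qed

lemma gamma_relators_subset: "gamma_relators A \<subseteq> carrier F"
  using Psi_relators by auto

lemma gamma_submodule: "submodule (gamma_ideal A) scalars F"
  unfolding gamma_ideal_def by (rule F.lin_span_submodule[OF gamma_relators_subset])

lemma Psi_gamma_ideal:
  assumes "p \<in> gamma_ideal A"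
  shows "Psi p = \<zero>\<^bsub>T\<^esub>"
proof -
  have "submodule {p \<in> carrier F. Psi p = \<zero>\<^bsub>T\<^esub>} scalars F"
    by (rule F.submoduleI') (auto simp: Psi_simps keys_pm_add subsetD[OF keys_pm_scale])
  then have "gamma_ideal A \<subseteq> {p \<in> carrier F. Psi p = \<zero>\<^bsub>T\<^esub>}"
    unfolding gamma_ideal_def
    by (rule F.lin_span_minimal[rotated]) (simp add: subset_eq Psi_relators[unfolded subset_eq])
  then show ?thesis
    using assms by blast
qed

end

section \<open>Injectivity\<close>

lemma pm_linear_iff:
  "Vector_Spaces.linear pm_scale ((*) :: 'f::field \<Rightarrow> _) f \<longleftrightarrow>
    (\<forall>p q. f (p + q) = f p + f q) \<and> (\<forall>c p. f (pm_scale c p) = c * f p)"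
  unfolding Vector_Spaces.linear_iff using pm.vector_space_axioms
  by (auto simp: vector_space_def algebra_simps)

lemma pm_linear_sum:
  assumes "Vector_Spaces.linear pm_scale ((*) :: 'f::field \<Rightarrow> _) f"
  shows "f p = (\<Sum>x\<in>Poly_Mapping.keys p. Poly_Mapping.lookup p x * f (Poly_Mapping.single x 1))"
proof -
  have add: "f (p + q) = f p + f q" and scale: "f (pm_scale c p) = c * f p" for c p q
    using assms by (simp_all add: pm_linear_iff)
  have zero: "f 0 = 0"
    using scale[of 0 0] by simp
  have "f (\<Sum>x\<in>K. Poly_Mapping.single x (Poly_Mapping.lookup p x)) =
      (\<Sum>x\<in>K. Poly_Mapping.lookup p x * f (Poly_Mapping.single x 1))" for K
  proof (induction K rule: infinite_finite_induct)
    case (insert x K)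
    then show ?case
      using scale[of "Poly_Mapping.lookup p x" "Poly_Mapping.single x 1"] by (simp add: add)
  qed (simp_all add: zero)
  then show ?thesis
    using pm_sum_single[of p] by metis
qed

context regular_hom_lie_algebra
begin

section \<open>Functionals on the tensor square\<close>

lemma iterate_twist_closed: "x \<in> carrier L \<Longrightarrow> (twist L ^^ n) x \<in> carrier L"
  by (induction n) (simp_all add: twist_closed)

lemma iterate_twist_add:
  "\<lbrakk>x \<in> carrier L; y \<in> carrier L\<rbrakk> \<Longrightarrow>
    (twist L ^^ n) (x \<oplus> y) = (twist L ^^ n) x \<oplus> (twist L ^^ n) y"
  by (induction n) (simp_all add: twist_add iterate_twist_closed)

lemma iterate_twist_smult: "x \<in> carrier L \<Longrightarrow> (twist L ^^ n) (c \<odot> x) = c \<odot> (twist L ^^ n) x"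
  by (induction n) (simp_all add: twist_smult iterate_twist_closed)

lemma iterate_twist_bracket:
  "\<lbrakk>x \<in> carrier L; y \<in> carrier L\<rbrakk> \<Longrightarrow>
    (twist L ^^ n) (bracket L x y) = bracket L ((twist L ^^ n) x) ((twist L ^^ n) y)"
  by (induction n) (simp_all add: twist_bracket iterate_twist_closed)

text \<open>Linear functionals on the abelianization, encoded as functions on \<open>L\<close> that
  vanish on the derived ideal; values outside the carrier are unconstrained.\<close>

definition ab_functional :: "('v \<Rightarrow> 'f) \<Rightarrow> bool"
  where "ab_functional f \<longleftrightarrow>
    (\<forall>x\<in>carrier L. \<forall>y\<in>carrier L. f (x \<oplus> y) = f x + f y) \<and>
    (\<forall>c. \<forall>x\<in>carrier L. f (c \<odot> x) = c * f x) \<and> (\<forall>d\<in>derived_ideal L. f d = 0)"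

lemma ab_functionalD:
  assumes "ab_functional f"
  shows "\<lbrakk>x \<in> carrier L; y \<in> carrier L\<rbrakk> \<Longrightarrow> f (x \<oplus> y) = f x + f y"
    and "x \<in> carrier L \<Longrightarrow> f (c \<odot> x) = c * f x"
    and "d \<in> derived_ideal L \<Longrightarrow> f d = 0"
  using assms by (simp_all add: ab_functional_def)

text \<open>In each relation that involves a bracket both sides evaluate to 0, since
  \<open>f\<close> and \<open>g\<close> kill the derived ideal. The remaining relations are
  bilinearity and the rule for twists.\<close>

lemma tensor_functional:
  assumes f: "ab_functional f" and g: "ab_functional g"
  shows "\<exists>\<epsilon>. (\<forall>s\<in>carrier T. \<forall>t\<in>carrier T. \<epsilon> (s \<oplus>\<^bsub>T\<^esub> t) = \<epsilon> s + \<epsilon> t) \<and>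
    (\<forall>c. \<forall>t\<in>carrier T. \<epsilon> (c \<odot>\<^bsub>T\<^esub> t) = c * \<epsilon> t) \<and>
    (\<forall>x\<in>carrier L. \<forall>y\<in>carrier L. \<epsilon> (x \<star> y) = f x * g y)"
proof -
  note fg = ab_functionalD[OF f] ab_functionalD[OF g]
  \<comment> \<open>The value of the functional on the \<open>n\<close>-fold twist of a generator,
    so that the relation \<open>twist_star\<close> holds by moving one twist from the level into the
    arguments.\<close>
  define b where "b n = (\<lambda>(x, y). f ((twist L ^^ n) x) * g ((twist L ^^ n) y))" for n :: nat
  have b: "b n (x, y) = f ((twist L ^^ n) x) * g ((twist L ^^ n) y)" for n x y
    by (simp add: b_def)
  have bracket_0: "f ((twist L ^^ n) (bracket L x y)) = 0" "g ((twist L ^^ n) (bracket L x y)) = 0"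
    if "x \<in> carrier L" "y \<in> carrier L" for n x y
    using that by (simp_all add: iterate_twist_bracket iterate_twist_closed bracket_in_derived fg)
  have rel: "hl_eval b s n = hl_eval b t n" if "star_rel L s t" for s t n
    using that
    by cases (simp_all add: b bracket_0 iterate_twist_add iterate_twist_smult iterate_twist_closed
        fg algebra_simps funpow_swap1)
  define \<epsilon> where "\<epsilon> t = hl_eval b (SOME s. s \<in> t) 0" for t
  have \<epsilon>: "\<epsilon> (hl_class (carrier L \<times> carrier L) (star_rel L) s) = hl_eval b s 0"
    if "gens s \<subseteq> carrier L \<times> carrier L" for s
  proof -
    let ?t = "hl_class (carrier L \<times> carrier L) (star_rel L) s"
    have "(SOME s'. s' \<in> ?t) \<in> ?t"
      using hl_class_self[OF that] by (rule someI)
    then have "hl_cong (star_rel L) s (SOME s'. s' \<in> ?t)"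
      by (simp add: hl_class_def)
    then have "hl_eval b s 0 = hl_eval b (SOME s'. s' \<in> ?t) 0"
      using rel by (rule hl_eval_cong)
    then show ?thesis
      by (simp add: \<epsilon>_def)
  qed
  have "\<epsilon> (s \<oplus>\<^bsub>T\<^esub> t) = \<epsilon> s + \<epsilon> t" "\<epsilon> (c \<odot>\<^bsub>T\<^esub> s) = c * \<epsilon> s"
    if "s \<in> carrier T" "t \<in> carrier T" for c s t
    using that by (auto simp: tensor_square_def presented_simps \<epsilon>)
  moreover have "\<epsilon> (x \<star> y) = f x * g y" if "x \<in> carrier L" "y \<in> carrier L" for x y
    using that by (simp add: star_def \<epsilon> b)
  ultimately show ?thesis
    by (intro exI[of _ \<epsilon>]) simp
qed

lemma Psi_functional:
  assumes p: "Poly_Mapping.keys p \<subseteq> carrier A" and Psi: "Psi p = \<zero>\<^bsub>T\<^esub>"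
    and f: "ab_functional f" and g: "ab_functional g"
  shows "(\<Sum>a\<in>Poly_Mapping.keys p. Poly_Mapping.lookup p a * (f (rep a) * g (rep a))) = 0"
proof -
  obtain \<epsilon> where
    \<epsilon>_add: "\<forall>s\<in>carrier T. \<forall>t\<in>carrier T. \<epsilon> (s \<oplus>\<^bsub>T\<^esub> t) = \<epsilon> s + \<epsilon> t" and
    \<epsilon>_smult: "\<forall>c. \<forall>t\<in>carrier T. \<epsilon> (c \<odot>\<^bsub>T\<^esub> t) = c * \<epsilon> t" and
    \<epsilon>_tensor: "\<forall>x\<in>carrier L. \<forall>y\<in>carrier L. \<epsilon> (x \<star> y) = f x * g y"
    using tensor_functional[OF f g] by (elim exE conjE)
  have zero: "\<epsilon> \<zero>\<^bsub>T\<^esub> = 0"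
    using \<epsilon>_smult[rule_format, of "\<zero>\<^bsub>T\<^esub>" 0] by simp
  have sum: "\<epsilon> (\<Oplus>\<^bsub>T\<^esub>a\<in>K. h a) = (\<Sum>a\<in>K. \<epsilon> (h a))" if "finite K" "h \<in> K \<rightarrow> carrier T" for h and K :: "'v set set"
    using that
    by (induction K rule: finite_induct) (simp_all add: zero \<epsilon>_add Pi_iff)
  have "\<epsilon> (Psi p) = (\<Sum>a\<in>Poly_Mapping.keys p. \<epsilon> (Poly_Mapping.lookup p a \<odot>\<^bsub>T\<^esub> sq a))"
    unfolding Psi_def lin_ext_def using p by (intro sum) (auto simp: sq_closed subset_eq)
  also have "\<dots> = (\<Sum>a\<in>Poly_Mapping.keys p. Poly_Mapping.lookup p a * (f (rep a) * g (rep a)))"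
  proof (rule sum.cong[OF HOL.refl])
    fix a assume "a \<in> Poly_Mapping.keys p"
    then have "a \<in> carrier A"
      using p by blast
    then show "\<epsilon> (Poly_Mapping.lookup p a \<odot>\<^bsub>T\<^esub> sq a) = Poly_Mapping.lookup p a * (f (rep a) * g (rep a))"
      by (simp add: \<epsilon>_smult sq_closed) (simp add: sq_def \<epsilon>_tensor rep)
  qed
  finally show ?thesis
    by (simp add: Psi zero)
qed

text \<open>If \<open>p\<close> were not in \<open>gamma_ideal A\<close>, a functional \<phi> would
  vanish on that ideal and be 1 at \<open>p\<close>. It restricts to a quadratic form on the
  generators, whose weighted sum over \<open>p\<close> must be 0.\<close>

lemma Psi_injective:
  assumes p: "Poly_Mapping.keys p \<subseteq> carrier A" and Psi: "Psi p = \<zero>\<^bsub>T\<^esub>"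
  shows "p \<in> gamma_ideal A"
proof (rule ccontr)
  assume p_notin: "p \<notin> gamma_ideal A"
  have "pm.subspace (gamma_ideal A)"
    using F.submodule_zero[OF gamma_submodule] F.submoduleE(4,5)[OF gamma_submodule]
    by (simp add: pm.subspace_def)
  from pm.separating_functional[OF this p_notin]
  obtain \<phi> where lin: "Vector_Spaces.linear pm_scale (*) \<phi>"
    and \<phi>_gamma: "\<forall>r\<in>gamma_ideal A. \<phi> r = 0" and \<phi>_p: "\<phi> p = 1"
    by (elim exE conjE)
  have add: "\<phi> (r + s) = \<phi> r + \<phi> s" and scale: "\<phi> (pm_scale c r) = c * \<phi> r" for r s c
    using lin by (simp_all add: pm_linear_iff)
  have diff: "\<phi> (r - s) = \<phi> r - \<phi> s" for r s
    using add[of "r - s" s] by simp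
  define q where "q a = \<phi> (Poly_Mapping.single a 1)" for a
  have single: "\<phi> (Poly_Mapping.single a c) = c * q a" for a c
    using scale[of c "Poly_Mapping.single a 1"] by (simp add: q_def)
  have rel: "\<phi> r = 0" if "r \<in> gamma_relators A" for r
    by (rule \<phi>_gamma[rule_format], unfold gamma_ideal_def, rule subsetD[OF F.lin_span_superset that])
  have q_smult: "q (c \<odot>\<^bsub>A\<^esub> a) = c^2 * q a" if "a \<in> carrier A" for a c
  proof -
    have "Poly_Mapping.single a (c^2) - Poly_Mapping.single (c \<odot>\<^bsub>A\<^esub> a) 1 \<in> gamma_relators A"
      unfolding gamma_relators_def using that by blast
    from rel[OF this] show ?thesis
      by (simp add: diff single)
  qed
  \<comment> \<open>The polar form of \<open>q\<close>: the second family of relators makes it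
    homogeneous in the first argument, and the third makes it additive in the second.\<close>
  define B where "B a b = q (a \<oplus>\<^bsub>A\<^esub> b) - q a - q b" for a b
  have B_smult_left: "B (c \<odot>\<^bsub>A\<^esub> a) b = c * B a b" if "a \<in> carrier A" "b \<in> carrier A" for a b c
  proof -
    have "(Poly_Mapping.single (c \<odot>\<^bsub>A\<^esub> a \<oplus>\<^bsub>A\<^esub> b) 1 + Poly_Mapping.single a c + Poly_Mapping.single b c)
      - (Poly_Mapping.single (a \<oplus>\<^bsub>A\<^esub> b) c + Poly_Mapping.single (c \<odot>\<^bsub>A\<^esub> a) 1 + Poly_Mapping.single b 1)
      \<in> gamma_relators A"
      unfolding gamma_relators_def using that by blast
    from rel[OF this] show ?thesis
      unfolding B_def by (simp add: diff add single algebra_simps)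
  qed
  have B_comm: "B a b = B b a" if "a \<in> carrier A" "b \<in> carrier A" for a b
    using that by (simp add: B_def A.a_comm)
  have B_smult_right: "B a (c \<odot>\<^bsub>A\<^esub> b) = c * B a b" if "a \<in> carrier A" "b \<in> carrier A" for a b c
    using that B_smult_left[of b a c] by (simp add: B_comm)
  have B_add_right: "B a (b \<oplus>\<^bsub>A\<^esub> c) = B a b + B a c"
    if "a \<in> carrier A" "b \<in> carrier A" "c \<in> carrier A" for a b c
  proof -
    have "(Poly_Mapping.single (a \<oplus>\<^bsub>A\<^esub> b \<oplus>\<^bsub>A\<^esub> c) 1 + Poly_Mapping.single a 1 + Poly_Mapping.single b 1
        + Poly_Mapping.single c 1)
      - (Poly_Mapping.single (a \<oplus>\<^bsub>A\<^esub> b) 1 + Poly_Mapping.single (a \<oplus>\<^bsub>A\<^esub> c) 1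
        + Poly_Mapping.single (b \<oplus>\<^bsub>A\<^esub> c) 1) \<in> gamma_relators A"
      unfolding gamma_relators_def using that by blast
    from rel[OF this] show ?thesis
      using that unfolding B_def by (simp add: diff add single algebra_simps A.a_assoc)
  qed
  have q_zero: "q \<zero>\<^bsub>A\<^esub> = 0"
    using q_smult[of "\<zero>\<^bsub>A\<^esub>" 0] by simp
  have B_zero: "B a \<zero>\<^bsub>A\<^esub> = 0" "B \<zero>\<^bsub>A\<^esub> a = 0" if "a \<in> carrier A" for a
    using that by (simp_all add: B_def q_zero)
  \<comment> \<open>\<open>quadratic_sum_eq_0\<close> concerns a vector space filling a whole type,
    whereas \<open>A\<close> lives on a carrier set. So \<open>A\<close> is replaced by the free
    space on the type of \<open>L\<close> modulo the kernel of \<sigma>; symbols outside the carrier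
    go to zero to make \<open>h\<close> total.\<close>
  define h where "h x = (if x \<in> carrier L then cls x else \<zero>\<^bsub>A\<^esub>)" for x
  have h: "h \<in> UNIV \<rightarrow> carrier A"
    by (simp add: h_def)
  define \<sigma> where "\<sigma> = lin_ext A h"
  have \<sigma>_closed [simp]: "\<sigma> r \<in> carrier A" for r
    unfolding \<sigma>_def by (rule A.lin_ext_closed[OF h]) simp
  have \<sigma>_0 [simp]: "\<sigma> 0 = \<zero>\<^bsub>A\<^esub>"
    unfolding \<sigma>_def by (rule A.lin_ext_0[OF h])
  have \<sigma>_add: "\<sigma> (r + s) = \<sigma> r \<oplus>\<^bsub>A\<^esub> \<sigma> s" for r s
    unfolding \<sigma>_def by (rule A.lin_ext_add[OF h]) simp_all
  have \<sigma>_scale: "\<sigma> (pm_scale c r) = c \<odot>\<^bsub>A\<^esub> \<sigma> r" for c r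
    unfolding \<sigma>_def by (rule A.lin_ext_smult[OF h]) simp
  have \<sigma>_single: "\<sigma> (Poly_Mapping.single x 1) = cls x" if "x \<in> carrier L" for x
    unfolding \<sigma>_def using that A.lin_ext_single[OF h, of x 1] by (simp add: h_def)
  let ?K = "{r. \<sigma> r = \<zero>\<^bsub>A\<^esub>}"
  \<comment> \<open>A functional that kills the kernel of \<sigma> depends on \<sigma> only, so its
    values on generators form a functional on the abelianization.\<close>
  have functional: "ab_functional (\<lambda>x. f (Poly_Mapping.single x 1))"
    if f: "Vector_Spaces.linear pm_scale (*) f" "\<And>r. r \<in> ?K \<Longrightarrow> f r = 0"
    for f :: "('v \<Rightarrow>\<^sub>0 'f) \<Rightarrow> 'f"
  proof -
    have f_add: "f (r + s) = f r + f s" and f_scale: "f (pm_scale c r) = c * f r" for r s c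
      using f(1) by (simp_all add: pm_linear_iff)
    have f_eq: "f r = f s" if "\<sigma> r = \<sigma> s" for r s
    proof -
      have "\<sigma> (r + pm_scale (- 1) s) = \<zero>\<^bsub>A\<^esub>"
        unfolding \<sigma>_add \<sigma>_scale that A.smult_minus_1[OF \<sigma>_closed] by (rule A.r_neg) simp
      then have "f (r + pm_scale (- 1) s) = 0"
        using f(2) by blast
      then show ?thesis
        unfolding f_add f_scale by simp
    qed
    have "f (Poly_Mapping.single (x \<oplus> y) 1) = f (Poly_Mapping.single x 1) + f (Poly_Mapping.single y 1)"
      if "x \<in> carrier L" "y \<in> carrier L" for x y
      unfolding f_add[symmetric] by (rule f_eq) (use that in \<open>simp add: \<sigma>_single \<sigma>_add cls_simps\<close>)
    moreover have "f (Poly_Mapping.single (c \<odot> x) 1) = c * f (Poly_Mapping.single x 1)"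
      if "x \<in> carrier L" for c x
      unfolding f_scale[symmetric]
      by (rule f_eq) (use that in \<open>simp only: \<sigma>_single \<sigma>_scale cls_simps scale_closed\<close>)
    moreover have "f (Poly_Mapping.single d 1) = 0" if "d \<in> derived_ideal L" for d
      using that by (intro f(2)) (simp add: \<sigma>_single cls_derived D.a_Hcarr)
    ultimately show ?thesis
      by (simp add: ab_functional_def)
  qed
  have "(\<Sum>a\<in>Poly_Mapping.keys p. Poly_Mapping.lookup p a * q (\<sigma> (Poly_Mapping.single (rep a) 1))) = 0"
  proof (rule pm.quadratic_sum_eq_0[where K = ?K and Q = "\<lambda>r. q (\<sigma> r)" and B = "\<lambda>r s. B (\<sigma> r) (\<sigma> s)"])
    show "pm.subspace ?K"
      by (simp add: pm.subspace_def \<sigma>_add \<sigma>_scale)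
    show "(\<Sum>a\<in>Poly_Mapping.keys p. Poly_Mapping.lookup p a *
        (f (Poly_Mapping.single (rep a) 1) * g (Poly_Mapping.single (rep a) 1))) = 0"
      if "Vector_Spaces.linear pm_scale (*) f" "Vector_Spaces.linear pm_scale (*) g"
        "\<And>r. r \<in> ?K \<Longrightarrow> f r = 0" "\<And>r. r \<in> ?K \<Longrightarrow> g r = 0" for f g :: "('v \<Rightarrow>\<^sub>0 'f) \<Rightarrow> 'f"
      by (rule Psi_functional[OF p Psi functional[OF that(1,3)] functional[OF that(2,4)]])
    show "q (\<sigma> (r + s)) = q (\<sigma> r) + q (\<sigma> s) + B (\<sigma> r) (\<sigma> s)" for r s
      by (simp add: \<sigma>_add B_def)
  qed (simp_all add: \<sigma>_add \<sigma>_scale q_smult q_zero B_smult_left B_smult_right B_add_right B_zero)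
  \<comment> \<open>The symbol of a lift of \<open>a\<close> goes to \<open>a\<close> under
    \<sigma>. The resulting sum is \<phi> at \<open>p\<close>, which equals 1.\<close>
  also have "(\<Sum>a\<in>Poly_Mapping.keys p. Poly_Mapping.lookup p a * q (\<sigma> (Poly_Mapping.single (rep a) 1))) =
      (\<Sum>a\<in>Poly_Mapping.keys p. Poly_Mapping.lookup p a * q a)"
    using p by (intro sum.cong) (auto simp: \<sigma>_single rep subset_eq)
  also have "\<dots> = \<phi> p"
    using pm_linear_sum[OF lin, of p] by (simp add: q_def)
  finally show False
    using \<phi>_p by simp
qed

section \<open>Assembly of the short exact sequence\<close>

lemma Psi_kernel: "p \<in> carrier F \<Longrightarrow> Psi p = \<zero>\<^bsub>T\<^esub> \<longleftrightarrow> p \<in> gamma_ideal A"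
  using Psi_injective Psi_gamma_ideal by auto

text \<open>Stability under the twist follows from the description of \<open>gamma_ideal A\<close>
  as the kernel of \<open>Psi\<close>, which commutes with twists.\<close>

sublocale Gam: hom_lie_ideal "gamma_ideal A" F
proof (rule hom_lie_ideal.intro[OF F.hom_lie_algebra_axioms hom_lie_ideal_axioms.intro])
  have sub: "gamma_ideal A \<subseteq> carrier F"
    by (rule F.submoduleE(1)[OF gamma_submodule])
  show "twist F p \<in> gamma_ideal A" if "p \<in> gamma_ideal A" for p
  proof -
    have "p \<in> carrier F"
      using sub that by blast
    then show ?thesis
      using that F.twist_closed[of p] by (simp add: Psi_twist Psi_gamma_ideal flip: Psi_kernel)
  qed
  show "bracket F p r \<in> gamma_ideal A" for p r
    using F.submodule_zero[OF gamma_submodule] by simp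
qed (rule gamma_submodule)

lemma Gamma_eq: "Gamma A = hom_quot F (gamma_ideal A)"
  by (simp add: Gamma_def)

text \<open>The first isomorphism theorem turns \<open>Psi\<close> into an injective map on
  \<open>Gamma A\<close> with the same image, and that image is the kernel of the projection to the
  exterior square.\<close>

lemma gamma_short_exact:
  "\<exists>\<psi>. short_exact (Gamma A) \<psi> T (exterior_proj L) (exterior_square L) \<and>
    (\<forall>x\<in>carrier L. \<psi> (gamma A (cls x)) = x \<star> x)"
proof -
  have "\<exists>\<psi>\<in>hom_lie_hom (Gamma A) T. inj_on \<psi> (carrier (Gamma A)) \<and>
      (\<forall>p\<in>carrier F. \<psi> (gamma_ideal A +>\<^bsub>F\<^esub> p) = Psi p)"
    unfolding Gamma_eq by (rule Gam.hom_quot_factor[OF T.hom_lie_algebra_axioms Psi_hom Psi_kernel])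
  then obtain \<psi> where hom: "\<psi> \<in> hom_lie_hom (Gamma A) T" and inj: "inj_on \<psi> (carrier (Gamma A))"
    and \<psi>: "\<forall>p\<in>carrier F. \<psi> (gamma_ideal A +>\<^bsub>F\<^esub> p) = Psi p"
    by (elim bexE conjE)
  have proj: "exterior_proj L = (\<lambda>t. square_ideal L +>\<^bsub>T\<^esub> t)"
    by (rule ext) (simp add: exterior_proj_def)
  have "\<psi> ` carrier (Gamma A) = Psi ` carrier F"
    unfolding Gamma_eq Gam.hom_quot_carrier image_image by (rule image_cong[OF HOL.refl \<psi>[rule_format]])
  then have "\<psi> ` carrier (Gamma A) = a_kernel T (exterior_square L) (exterior_proj L)"
    unfolding proj exterior_square_def Sq.a_kernel_proj Psi_image .
  moreover have "\<psi> (gamma A (cls x)) = x \<star> x" if "x \<in> carrier L" for x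
    unfolding gamma_def using that \<psi>[rule_format, of "Poly_Mapping.single (cls x) 1"] by (simp add: Psi_simps sq_cls)
  moreover have "hom_lie_algebra (Gamma A)" "hom_lie_algebra (exterior_square L)"
    "exterior_proj L \<in> hom_lie_hom T (exterior_square L)"
    "exterior_proj L ` carrier T = carrier (exterior_square L)"
    unfolding Gamma_eq exterior_square_def proj
    by (rule Gam.hom_quot_hom_lie_algebra Sq.hom_quot_hom_lie_algebra Sq.hom_quot_proj
        Sq.hom_quot_carrier[symmetric])+
  ultimately show ?thesis
    using hom inj T.hom_lie_algebra_axioms unfolding short_exact_def by blast
qed

end

theorem proposition3p5:
  fixes L :: "('f::field, 'v) hom_alg"
  assumes "hom_lie_algebra L"
    and "twist L ` carrier L = carrier L"
  shows "\<exists>\<psi>. short_exact (Gamma (abelianization L)) \<psi> (tensor_square L)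
        (exterior_proj L) (exterior_square L) \<and>
      (\<forall>x\<in>carrier L. \<psi> (gamma (abelianization L) (ab_class L x)) = star L x x)"
proof -
  interpret regular_hom_lie_algebra L
    using assms by (simp add: regular_hom_lie_algebra_def regular_hom_lie_algebra_axioms_def)
  show ?thesis
    by (rule gamma_short_exact)
qed

end
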